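(* Every uniform algebra $A$, regarded as a complex Banach space with the supremum norm, satisfies the complex Mazur-Ulam property; that is, for every complex Banach space $B$ and every surjective isometry $T:S(A)\to S(B)$, there is a surjective real-linear isometry from $A$ onto $B$ which extends $T$.
   Context: A uniform algebra is a uniformly closed subalgebra of $C(X,\mathbb{C})$ (the algebra of all complex-valued continuous functions on a compact Hausdorff space $X$) which contains the constant functions and separates the points of $X$; it carries the supremum norm. For a Banach space $B$, $S(B)=\{a\in B:\|a\|=1\}$ denotes the unit sphere, with the metric induced by the norm. A surjective isometry between unit spheres is a surjective map $T$ with $\|T(a)-T(b)\|=\|a-b\|$ for all $a,b$ (no linearity assumed). A complex Banach space $B_1$ satisfies the complex Mazur-Ulam property if, for every complex Banach space $B_2$, every surjective isometry $S(B_1)\to S(B_2)$ extends to a surjective real-linear isometry $B_1\to B_2$. *)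

theory Defs
  imports "HOL-Analysis.Analysis"
begin

class complex_normed_vector = real_normed_vector +
  fixes scaleC :: "complex \<Rightarrow> 'a \<Rightarrow> 'a"  (infixr \<open>*\<^sub>C\<close> 75)
  assumes scaleC_add_right: "c *\<^sub>C (x + y) = c *\<^sub>C x + c *\<^sub>C y"
    and scaleC_add_left: "(c + d) *\<^sub>C x = c *\<^sub>C x + d *\<^sub>C x"
    and scaleC_scaleC: "c *\<^sub>C d *\<^sub>C x = (c * d) *\<^sub>C x"
    and scaleR_scaleC: "r *\<^sub>R x = complex_of_real r *\<^sub>C x"
    and norm_scaleC: "norm (c *\<^sub>C x) = cmod c * norm x"

interpretation complex_vector:
  vector_space "scaleC :: complex \<Rightarrow> 'a \<Rightarrow> 'a::complex_normed_vector"
proof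
  fix x :: 'a
  show "1 *\<^sub>C x = x"
    using scaleR_scaleC[of 1 x] by simp
qed (simp_all add: scaleC_add_right scaleC_add_left scaleC_scaleC)

instantiation complex :: complex_normed_vector
begin

definition scaleC_complex :: "complex \<Rightarrow> complex \<Rightarrow> complex"
  where "scaleC_complex c z = c * z"

instance
  by standard
    (simp_all add: scaleC_complex_def algebra_simps scaleR_conv_of_real norm_mult)

end

instantiation bcontfun :: (topological_space, complex_normed_vector) complex_normed_vector
begin

lemma dist_scaleC: "dist (c *\<^sub>C x) (c *\<^sub>C y) = cmod c * dist x y"
  for x y :: "'c::complex_normed_vector"
  by (simp add: dist_norm norm_scaleC flip: complex_vector.scale_right_diff_distrib)

lemma scaleC_cont: "(\<lambda>x. c *\<^sub>C apply_bcontfun f x) \<in> bcontfun"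
  for f :: "'a \<Rightarrow>\<^sub>C 'b"
proof (rule bcontfun_normI)
  have "continuous_on UNIV (\<lambda>x. c *\<^sub>C x :: 'b)"
  proof (rule lipschitz_on_continuous_on)
    show "(cmod c)-lipschitz_on UNIV (\<lambda>x. c *\<^sub>C x :: 'b)"
      by (rule lipschitz_onI) (simp_all add: dist_scaleC)
  qed
  then show "continuous_on UNIV (\<lambda>x. c *\<^sub>C apply_bcontfun f x)"
    by (rule continuous_on_compose2) auto
  show "norm (c *\<^sub>C apply_bcontfun f x) \<le> cmod c * norm f" for x
    by (simp add: norm_scaleC norm_bounded mult_left_mono)
qed

definition scaleC_bcontfun :: "complex \<Rightarrow> ('a \<Rightarrow>\<^sub>C 'b) \<Rightarrow> ('a \<Rightarrow>\<^sub>C 'b)"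
  where "scaleC_bcontfun c f = Bcontfun (\<lambda>x. c *\<^sub>C apply_bcontfun f x)"

lemma apply_bcontfun_scaleC [simp]:
  "apply_bcontfun (c *\<^sub>C f) x = c *\<^sub>C apply_bcontfun f x" for f :: "'a \<Rightarrow>\<^sub>C 'b"
  by (simp add: scaleC_bcontfun_def Bcontfun_inverse scaleC_cont)

instance
proof
  fix c d :: complex and r :: real and f g :: "'a \<Rightarrow>\<^sub>C 'b"
  show "c *\<^sub>C (f + g) = c *\<^sub>C f + c *\<^sub>C g"
    by (rule bcontfun_eqI) (simp add: scaleC_add_right)
  show "(c + d) *\<^sub>C f = c *\<^sub>C f + d *\<^sub>C f"
    by (rule bcontfun_eqI) (simp add: scaleC_add_left)
  show comp: "c *\<^sub>C d *\<^sub>C f = (c * d) *\<^sub>C f" for c d and f :: "'a \<Rightarrow>\<^sub>C 'b"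
    by (rule bcontfun_eqI) (simp add: scaleC_scaleC)
  show "r *\<^sub>R f = complex_of_real r *\<^sub>C f"
    by (rule bcontfun_eqI) (simp add: scaleR_scaleC)
  have le: "norm (c *\<^sub>C f) \<le> cmod c * norm f" for c and f :: "'a \<Rightarrow>\<^sub>C 'b"
    by (rule norm_bound) (simp add: norm_scaleC norm_bounded mult_left_mono)
  show "norm (c *\<^sub>C f) = cmod c * norm f"
  proof (cases "c = 0")
    case True
    then show ?thesis
      using le[of c f] by simp
  next
    case False
    have "inverse c *\<^sub>C c *\<^sub>C f = f"
      using False by (intro bcontfun_eqI) simp
    then have "norm f \<le> cmod (inverse c) * norm (c *\<^sub>C f)"
      using le[of "inverse c" "c *\<^sub>C f"] by simp
    then have "cmod c * norm f \<le> norm (c *\<^sub>C f)"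
      using False by (simp add: norm_divide field_simps)
    then show ?thesis
      using le[of c f] by simp
  qed
qed

end

instantiation bcontfun :: (topological_space, real_normed_algebra) real_normed_algebra
begin

lemma times_cont: "(\<lambda>x. apply_bcontfun f x * apply_bcontfun g x) \<in> bcontfun"
  for f g :: "'a \<Rightarrow>\<^sub>C 'b"
proof (rule bcontfun_normI)
  show "continuous_on UNIV (\<lambda>x. apply_bcontfun f x * apply_bcontfun g x)"
    by (intro continuous_intros) auto
  show "norm (apply_bcontfun f x * apply_bcontfun g x) \<le> norm f * norm g" for x
    by (rule order_trans[OF norm_mult_ineq]) (simp add: mult_mono norm_bounded)
qed

definition times_bcontfun :: "('a \<Rightarrow>\<^sub>C 'b) \<Rightarrow> ('a \<Rightarrow>\<^sub>C 'b) \<Rightarrow> ('a \<Rightarrow>\<^sub>C 'b)"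
  where "times_bcontfun f g = Bcontfun (\<lambda>x. apply_bcontfun f x * apply_bcontfun g x)"

lemma apply_bcontfun_times [simp]:
  "apply_bcontfun (f * g) x = apply_bcontfun f x * apply_bcontfun g x" for f g :: "'a \<Rightarrow>\<^sub>C 'b"
  by (simp add: times_bcontfun_def Bcontfun_inverse times_cont)

instance
proof
  fix f g :: "'a \<Rightarrow>\<^sub>C 'b"
  show "norm (f * g) \<le> norm f * norm g"
    by (rule norm_bound, simp, rule order_trans[OF norm_mult_ineq])
      (simp add: mult_mono norm_bounded)
qed (rule bcontfun_eqI, simp add: algebra_simps)+

end

text \<open>
  Complex Banach spaces are represented as complete complex-linear subspaces of a complex normed
  space; the case \<open>V = UNIV\<close> is a Banach space given as a whole type.
\<close>

definition complex_banach_space :: "'a::complex_normed_vector set \<Rightarrow> bool"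
  where "complex_banach_space V \<longleftrightarrow> complex_vector.subspace V \<and> complete V"

definition unit_sphere :: "'a::real_normed_vector set \<Rightarrow> 'a set"
  where "unit_sphere V = {a \<in> V. norm a = 1}"

definition surjective_isometry ::
    "'a::metric_space set \<Rightarrow> 'b::metric_space set \<Rightarrow> ('a \<Rightarrow> 'b) \<Rightarrow> bool"
  where "surjective_isometry M N T \<longleftrightarrow>
    T ` M = N \<and> (\<forall>a\<in>M. \<forall>b\<in>M. dist (T a) (T b) = dist a b)"

definition real_linear_on ::
    "'a::real_vector set \<Rightarrow> ('a \<Rightarrow> 'b::real_vector) \<Rightarrow> bool"
  where "real_linear_on V F \<longleftrightarrow>
    (\<forall>x\<in>V. \<forall>y\<in>V. F (x + y) = F x + F y) \<and> (\<forall>r. \<forall>x\<in>V. F (r *\<^sub>R x) = r *\<^sub>R F x)"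

text \<open>
  A definition cannot quantify over types, so the type of the ambient space of the target is a
  parameter. The quantification over all complex Banach spaces is completed by leaving \<open>'b\<close> a free
  type variable in theorems.
\<close>

definition complex_mazur_ulam ::
    "'b::complex_normed_vector itself \<Rightarrow> 'a::complex_normed_vector set \<Rightarrow> bool"
  where "complex_mazur_ulam TYPE('b) B1 \<longleftrightarrow>
    complex_banach_space B1 \<and>
    (\<forall>B2 :: 'b set. complex_banach_space B2 \<longrightarrow>
      (\<forall>T. surjective_isometry (unit_sphere B1) (unit_sphere B2) T \<longrightarrow>
        (\<exists>F. surjective_isometry B1 B2 F \<and> real_linear_on B1 F \<and>
             (\<forall>a \<in> unit_sphere B1. F a = T a))))"

text \<open>
  When \<open>'x\<close> is compact, \<open>'x \<Rightarrow>\<^sub>C complex\<close> consists of all continuous functions, with the supremum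
  norm; closedness below is thus uniform closedness.
\<close>

definition uniform_algebra :: "('x::t2_space \<Rightarrow>\<^sub>C complex) set \<Rightarrow> bool"
  where "uniform_algebra A \<longleftrightarrow>
    compact (UNIV :: 'x set) \<and>
    closed A \<and>
    complex_vector.subspace A \<and>
    (\<forall>f\<in>A. \<forall>g\<in>A. f * g \<in> A) \<and>
    (\<forall>c. const_bcontfun c \<in> A) \<and>
    (\<forall>x y. x \<noteq> y \<longrightarrow> (\<exists>f\<in>A. apply_bcontfun f x \<noteq> apply_bcontfun f y))"

end

theory Submission
  imports Defs
begin

text \<open>
  Points \<open>x\<close> for which \<open>{x}\<close> is a weak peak set carry the whole proof. The convex subsets of
  \<open>S(A)\<close> lie in faces \<open>F(x,c) = {a \<in> S(A). a x = c}\<close> with such \<open>x\<close> and \<open>\<bar>c\<bar> = 1\<close>, and for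
  \<open>a x = r c\<close> with \<open>-1 \<le> r \<le> 1\<close> the distance from \<open>a\<close> to \<open>F(x,c)\<close> is \<open>1 - r\<close>. An isometry \<open>T\<close>
  maps \<open>F(x,1)\<close> onto a face \<open>D\<close> of \<open>S(B)\<close>, cut out by a complex functional \<open>q\<close> of norm 1. Each rotation
  \<open>m D\<close> is again the image of a face, and it must be \<open>F(x,t(m))\<close>, where \<open>t\<close> is an isometry of the circle
  fixing 1, hence the identity or the conjugation. The distances to \<open>F(x,c)\<close> and \<open>F(x,-c)\<close> confine
  \<open>q (T a)\<close> to two tangent discs, so \<open>q (T a)\<close> is \<open>a x\<close> or its conjugate. These functionals separate
  the points of \<open>B\<close>, which forces the homogeneous extension of \<open>T\<close> to be additive.
\<close>

section \<open>Sublinear functionals and faces of the unit ball\<close>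

text \<open>The obstacle is that \<open>T\<close> is known only metrically: it need not respect
  midpoints or rotations. The substitute is antipodality, distance 2, which \<open>T\<close>
  preserves: a point at distance 2 from a midpoint in the ball is at distance 2 from both ends, and
  antipodal points have a common functional of norm 1 with values 1 and -1. Hence the hull of the
  image of a convex subset of the sphere stays on the sphere, for \<open>T\<close> and for its
  inverse, and maximal convex sets correspond. That a rotated face stays over the same
  \<open>x\<close> is again metric. Multiplication by \<open>m\<close> moves unit vectors by
  \<open>cmod (1 - m)\<close>, while for \<open>y \<noteq> x\<close> a face over \<open>x\<close>
  has members almost 1 or more away from every face over \<open>y\<close>. So
  \<open>cmod (1 - m) < 1\<close> keeps \<open>x\<close>, and every rotation is a fourth power of
  such a one. Identity or conjugation is decided separately at each \<open>x\<close>, hence only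
  real linearity. The functionals separate points because each unit vector of \<open>B\<close> is
  some \<open>T a\<close>, and the convex set \<open>{a}\<close> lies in a face over some
  \<open>x\<close>.\<close>

definition sublinear :: "('a::real_vector \<Rightarrow> real) \<Rightarrow> bool"
  where "sublinear p \<longleftrightarrow> (\<forall>x y. p (x + y) \<le> p x + p y) \<and> (\<forall>r\<ge>0. \<forall>x. p (r *\<^sub>R x) = r * p x)"

lemma sublinearD:
  assumes "sublinear p"
  shows "p (x + y) \<le> p x + p y" "r \<ge> 0 \<Longrightarrow> p (r *\<^sub>R x) = r * p x" "p 0 = 0" "- p (- x) \<le> p x"
proof -
  show add: "p (x + y) \<le> p x + p y" for x y
    using assms by (simp add: sublinear_def)
  show "r \<ge> 0 \<Longrightarrow> p (r *\<^sub>R x) = r * p x" for r x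
    using assms by (simp add: sublinear_def)
  from this[of 0 x] show "p 0 = 0" by simp
  with add[of x "- x"] show "- p (- x) \<le> p x" by simp
qed

lemma INF_scale:
  fixes f :: "'a \<Rightarrow> real"
  assumes "A \<noteq> {}" "bdd_below (f ` A)" "r > 0"
  shows "(INF x\<in>A. r * f x) = r * (INF x\<in>A. f x)"
proof (rule antisym)
  have bdd: "bdd_below ((\<lambda>x. r * f x) ` A)"
    using assms by (intro bdd_belowI2[where m = "r * (INF x\<in>A. f x)"])
      (simp add: cINF_lower)
  have "(INF x\<in>A. r * f x) / r \<le> (INF x\<in>A. f x)"
    by (rule cINF_greatest[OF assms(1)])
      (use assms cINF_lower[OF bdd] in \<open>auto simp: pos_divide_le_eq mult.commute\<close>)
  then show "(INF x\<in>A. r * f x) \<le> r * (INF x\<in>A. f x)"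
    using assms by (simp add: pos_divide_le_eq mult.commute)
  show "r * (INF x\<in>A. f x) \<le> (INF x\<in>A. r * f x)"
    by (rule cINF_greatest) (use assms in \<open>auto intro: cINF_lower\<close>)
qed

text \<open>Infimal convolution over the cone \<open>K\<close>: as \<open>g \<le> p\<close> on
  \<open>K\<close>, the values stay above \<open>- p (- x)\<close>. Taking \<open>x = - d\<close>
  shows that a linear functional below the result is at least \<open>g d\<close> at
  \<open>d \<in> K\<close>, the sandwich step of Hahn-Banach. It serves twice: for a ray with
  \<open>g = p\<close>, and for the cone over a convex set with \<open>g = norm\<close>.\<close>

lemma sublinear_INF_cone:
  assumes p: "sublinear p" and K: "\<And>d e. d \<in> K \<Longrightarrow> e \<in> K \<Longrightarrow> d + e \<in> K"
    "\<And>d r. d \<in> K \<Longrightarrow> r > 0 \<Longrightarrow> r *\<^sub>R d \<in> K" "0 \<in> K"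
    and g: "\<And>d e. d \<in> K \<Longrightarrow> e \<in> K \<Longrightarrow> g d + g e \<le> g (d + e)"
    "\<And>d r. d \<in> K \<Longrightarrow> r > 0 \<Longrightarrow> g (r *\<^sub>R d) = r * g d" "g 0 = 0"
    and le: "\<And>d. d \<in> K \<Longrightarrow> g d \<le> p d"
  shows "sublinear (\<lambda>x. INF d\<in>K. p (x + d) - g d)"
    and "d \<in> K \<Longrightarrow> (INF d\<in>K. p (x + d) - g d) \<le> p (x + d) - g d"
proof -
  have bdd: "bdd_below ((\<lambda>d. p (x + d) - g d) ` K)" for x
  proof (rule bdd_belowI2)
    fix d assume "d \<in> K"
    then show "- p (- x) \<le> p (x + d) - g d"
      using le[of d] sublinearD(1)[OF p, of "x + d" "- x"] by simp
  qed
  show low: "d \<in> K \<Longrightarrow> (INF d\<in>K. p (x + d) - g d) \<le> p (x + d) - g d" for x d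
    by (rule cINF_lower[OF bdd])
  have ne: "K \<noteq> {}" using K(3) by blast
  let ?P = "\<lambda>x. INF d\<in>K. p (x + d) - g d"
  show "sublinear ?P"
    unfolding sublinear_def
  proof (intro conjI allI impI)
    fix x y
    have *: "?P (x + y) \<le> (p (x + d) - g d) + (p (y + e) - g e)" if "d \<in> K" "e \<in> K" for d e
    proof -
      have "?P (x + y) \<le> p ((x + y) + (d + e)) - g (d + e)"
        by (rule low) (simp add: K that)
      also have "(x + y) + (d + e) = (x + d) + (y + e)" by simp
      finally show ?thesis
        using sublinearD(1)[OF p, of "x + d" "y + e"] g(1)[OF that] by linarith
    qed
    have "?P (x + y) - (p (x + d) - g d) \<le> ?P y" if "d \<in> K" for d
      by (rule cINF_greatest[OF ne]) (use *[OF that] in \<open>simp add: algebra_simps\<close>)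
    then have "?P (x + y) - ?P y \<le> ?P x"
      by (intro cINF_greatest[OF ne]) (simp add: algebra_simps)
    then show "?P (x + y) \<le> ?P x + ?P y" by simp
  next
    fix r :: real and x assume "0 \<le> r"
    show "?P (r *\<^sub>R x) = r * ?P x"
    proof (cases "r = 0")
      case True
      have "?P 0 \<le> 0" using low[OF K(3), of 0] sublinearD(3)[OF p] g(3) by simp
      moreover have "0 \<le> ?P 0" by (rule cINF_greatest[OF ne]) (simp add: le)
      ultimately show ?thesis using True by simp
    next
      case False
      then have r: "r > 0" using \<open>0 \<le> r\<close> by simp
      have img: "K = (\<lambda>d. r *\<^sub>R d) ` K"
      proof (intro equalityI subsetI)
        fix d assume "d \<in> K"
        then have "(1 / r) *\<^sub>R d \<in> K" using r K(2) by simp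
        then show "d \<in> (\<lambda>d. r *\<^sub>R d) ` K"
          using r by (intro image_eqI[where x = "(1 / r) *\<^sub>R d"]) auto
      qed (use K(2) r in auto)
      have "?P (r *\<^sub>R x) = (INF d\<in>(\<lambda>d. r *\<^sub>R d) ` K. p (r *\<^sub>R x + d) - g d)"
        using img by simp
      also have "\<dots> = (INF d\<in>K. p (r *\<^sub>R x + r *\<^sub>R d) - g (r *\<^sub>R d))"
        by (simp add: image_image)
      also have "\<dots> = (INF d\<in>K. r * (p (x + d) - g d))"
      proof (rule INF_cong[OF refl])
        fix d assume "d \<in> K"
        then show "p (r *\<^sub>R x + r *\<^sub>R d) - g (r *\<^sub>R d) = r * (p (x + d) - g d)"
          using sublinearD(2)[OF p, of r "x + d"] r g(2)
          by (simp add: scaleR_add_right right_diff_distrib)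
      qed
      also have "\<dots> = r * ?P x"
        by (rule INF_scale[OF ne bdd r])
      finally show ?thesis .
    qed
  qed
qed

text \<open>A minimal sublinear functional \<open>q\<close> is linear: the functional
  \<open>x \<mapsto> INF t\<ge>0. q (x + t y) - t q y\<close> is sublinear and below \<open>q\<close>, so
  \<open>q x + q y \<le> q (x + y)\<close>.\<close>

lemma sublinear_dominates_linear:
  assumes "sublinear p"
  shows "\<exists>q. linear q \<and> (\<forall>x. q x \<le> p x)"
proof -
  let ?S = "{q. sublinear q \<and> q \<le> p}"
  let ?R = "relation_of (\<lambda>a b. b \<le> a) ?S"
  have "\<exists>m\<in>?S. \<forall>a\<in>?S. a \<le> m \<longrightarrow> a = m"
  proof (rule predicate_Zorn)
    show "partial_order_on ?S ?R"
      by (auto simp: relation_of_def partial_order_on_def preorder_on_def refl_on_def trans_def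
          antisym_def)
  next
    fix C assume C: "C \<in> Chains ?R"
    then have lin: "a \<le> b \<or> b \<le> a" if "a \<in> C" "b \<in> C" for a b
      using that by (auto simp: Chains_def relation_of_def)
    show "\<exists>u\<in>?S. \<forall>a\<in>C. u \<le> a"
    proof (cases "C = {}")
      case True
      then show ?thesis using assms by auto
    next
      case False
      have CS: "C \<subseteq> ?S" using C by (auto simp: Chains_def relation_of_def)
      have bdd: "bdd_below ((\<lambda>q. q x) ` C)" for x
      proof (rule bdd_belowI2)
        fix q assume "q \<in> C"
        then have "sublinear q" "q (- x) \<le> p (- x)" using CS by (auto simp: le_fun_def)
        then show "- p (- x) \<le> q x" using sublinearD(4)[of q x] by linarith
      qed
      let ?u = "\<lambda>x. INF q\<in>C. q x"
      have low: "?u x \<le> q x" if "q \<in> C" for q x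
        by (rule cINF_lower[OF bdd that])
      have "sublinear ?u"
        unfolding sublinear_def
      proof (intro conjI allI impI)
        fix x y
        have *: "?u (x + y) \<le> a x + b y" if ab: "a \<in> C" "b \<in> C" for a b
        proof -
          obtain c where c: "c \<in> C" "c \<le> a" "c \<le> b" using lin[OF ab] ab by blast
          have "?u (x + y) \<le> c x + c y"
            using low[OF c(1), of "x + y"] sublinearD(1)[of c x y] c(1) CS by fastforce
          then show ?thesis using le_funD[OF c(2), of x] le_funD[OF c(3), of y] by linarith
        qed
        have "?u (x + y) - a x \<le> ?u y" if "a \<in> C" for a
          by (rule cINF_greatest[OF False]) (use *[OF that] in \<open>simp add: algebra_simps\<close>)
        then have "?u (x + y) - ?u y \<le> ?u x"
          by (intro cINF_greatest[OF False]) (simp add: algebra_simps)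
        then show "?u (x + y) \<le> ?u x + ?u y" by simp
      next
        fix r :: real and x assume r: "0 \<le> r"
        have "?u (r *\<^sub>R x) = (INF q\<in>C. r * q x)"
          by (rule INF_cong[OF refl]) (use CS sublinearD(2) r in blast)
        also have "\<dots> = r * ?u x"
          using INF_scale[OF False bdd, of r x] r False by (cases "r = 0") auto
        finally show "?u (r *\<^sub>R x) = r * ?u x" .
      qed
      moreover obtain c where "c \<in> C" using False by blast
      then have "?u \<le> p" using low[of c] CS by (auto simp: le_fun_def intro: order_trans)
      ultimately show ?thesis using low by (auto simp: le_fun_def)
    qed
  qed
  then obtain q where q: "sublinear q" "q \<le> p" and min: "\<And>a. sublinear a \<Longrightarrow> a \<le> q \<Longrightarrow> a = q"
    by (auto intro: order_trans)
  have add: "q (x + y) = q x + q y" for x y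
  proof -
    define K where "K = {d. \<exists>t\<ge>0. d = t *\<^sub>R y}"
    let ?P = "\<lambda>x. INF d\<in>K. q (x + d) - q d"
    have K: "0 \<in> K" "y \<in> K" by (auto simp: K_def intro: exI[of _ 0] exI[of _ 1])
    have K1: "d + e \<in> K" "q d + q e \<le> q (d + e)" if de: "d \<in> K" "e \<in> K" for d e
    proof -
      obtain s t where st: "s \<ge> 0" "t \<ge> 0" "d = s *\<^sub>R y" "e = t *\<^sub>R y"
        using de by (auto simp: K_def)
      then show "q d + q e \<le> q (d + e)"
        using sublinearD(2)[OF q(1), of _ y] by (simp add: algebra_simps flip: scaleR_add_left)
      show "d + e \<in> K"
        using st by (auto simp: K_def simp flip: scaleR_add_left intro: add_nonneg_nonneg)
    qed
    have K2: "r *\<^sub>R d \<in> K" if "d \<in> K" "r > 0" for d r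
    proof -
      obtain t where "d = t *\<^sub>R y" "t \<ge> 0" using \<open>d \<in> K\<close> by (auto simp: K_def)
      then show ?thesis using \<open>r > 0\<close> by (auto simp: K_def intro!: exI[of _ "r * t"])
    qed
    have P: "sublinear ?P" "d \<in> K \<Longrightarrow> ?P x \<le> q (x + d) - q d" for d x
      by (rule sublinear_INF_cone[OF q(1), where K = K and g = q];
          simp add: K K1 K2 sublinearD(2,3)[OF q(1)])+
    have "?P = q"
    proof (rule min[OF P(1)])
      show "?P \<le> q" using P(2)[OF K(1)] sublinearD(3)[OF q(1)] by (simp add: le_fun_def)
    qed
    then have "q x \<le> q (x + y) - q y" using P(2)[OF K(2), of x] by metis
    then show ?thesis using sublinearD(1)[OF q(1), of x y] by simp
  qed
  have neg: "q (- x) = - q x" for x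
    using add[of x "- x"] sublinearD(3)[OF q(1)] by simp
  have "linear q"
  proof (rule linearI)
    show "q (r *\<^sub>R x) = r *\<^sub>R q x" for r x
      using sublinearD(2)[OF q(1), of r x] sublinearD(2)[OF q(1), of "- r" x] neg[of "r *\<^sub>R x"]
      by (cases "r \<ge> 0") auto
  qed (rule add)
  then show ?thesis using q(2) by (auto simp: le_fun_def)
qed

text \<open>Convexity makes the norm additive on the cone over \<open>D\<close>: a sum of positive
  multiples of points of \<open>D\<close> is a multiple of a point of \<open>D\<close>, with the
  coefficients added. So \<open>g = norm\<close> is admissible in the infimal convolution, and the
  functional obtained reaches the norm on \<open>D\<close>.\<close>

lemma convex_sphere_functional:
  fixes D :: "'a::real_normed_vector set"
  assumes "convex D" "\<And>d. d \<in> D \<Longrightarrow> norm d = 1"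
  shows "\<exists>q. linear q \<and> (\<forall>x. q x \<le> norm x) \<and> (\<forall>d\<in>D. q d = 1)"
proof -
  define K where "K = {0} \<union> {t *\<^sub>R d |t d. t > 0 \<and> d \<in> D}"
  have norm: "sublinear (norm :: 'a \<Rightarrow> real)"
    by (auto simp: sublinear_def norm_triangle_ineq)
  have sum: "\<exists>f\<in>D. s *\<^sub>R d + t *\<^sub>R e = (s + t) *\<^sub>R f" if "d \<in> D" "e \<in> D" "s > 0" "t > 0" for d e s t
  proof (rule bexI)
    show "(s / (s + t)) *\<^sub>R d + (t / (s + t)) *\<^sub>R e \<in> D"
      using assms(1) that by (intro convexD) (auto simp: add_divide_distrib[symmetric])
    show "s *\<^sub>R d + t *\<^sub>R e = (s + t) *\<^sub>R ((s / (s + t)) *\<^sub>R d + (t / (s + t)) *\<^sub>R e)"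
      using that by (simp add: scaleR_add_right)
  qed
  have Kadd: "d + e \<in> K \<and> norm d + norm e \<le> norm (d + e)" if "d \<in> K" "e \<in> K" for d e
  proof (cases "d = 0 \<or> e = 0")
    case False
    then obtain s t d' e' where *: "d = s *\<^sub>R d'" "e = t *\<^sub>R e'" "s > 0" "t > 0" "d' \<in> D" "e' \<in> D"
      using \<open>d \<in> K\<close> \<open>e \<in> K\<close> by (auto simp: K_def)
    then obtain f where "f \<in> D" "d + e = (s + t) *\<^sub>R f" using sum by blast
    then show ?thesis using * assms(2) by (auto simp: K_def intro: add_pos_pos)
  qed (use that in auto)
  have Kscale: "r *\<^sub>R d \<in> K" if "d \<in> K" "r > 0" for d r
  proof (cases "d = 0")
    case False
    then obtain t e where "d = t *\<^sub>R e" "t > 0" "e \<in> D" using \<open>d \<in> K\<close> by (auto simp: K_def)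
    then show ?thesis using \<open>r > 0\<close> by (auto simp: K_def intro!: exI[of _ "r * t"] exI[of _ e])
  qed (simp add: K_def)
  let ?P = "\<lambda>x. INF d\<in>K. norm (x + d) - norm d"
  have P: "sublinear ?P" "d \<in> K \<Longrightarrow> ?P x \<le> norm (x + d) - norm d" for d x
    by (rule sublinear_INF_cone[OF norm, where K = K and g = norm];
        (simp add: Kadd Kscale; fail | simp add: K_def))+
  obtain q where q: "linear q" "\<And>x. q x \<le> ?P x"
    using sublinear_dominates_linear[OF P(1)] by blast
  have le: "q x \<le> norm x" for x
    using q(2)[of x] P(2)[of 0 x] by (simp add: K_def)
  moreover have "q d = 1" if "d \<in> D" for d
  proof -
    have "d \<in> K" using that by (auto simp: K_def intro!: exI[of _ 1])
    then have "q (- d) \<le> - 1" using q(2)[of "- d"] P(2)[of d "- d"] assms(2)[OF that] by simp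
    then show ?thesis using le[of d] assms(2)[OF that] linear_neg[OF q(1), of d] by simp
  qed
  ultimately show ?thesis using q(1) by blast
qed

section \<open>Convex sets under isometries of spheres\<close>

lemma surjective_isometry_inj: "surjective_isometry M N T \<Longrightarrow> inj_on T M"
  unfolding surjective_isometry_def inj_on_def by (metis dist_eq_0_iff)

lemma surjective_isometry_inv_into:
  assumes "surjective_isometry M N T"
  shows "surjective_isometry N M (inv_into M T)"
  unfolding surjective_isometry_def
proof (intro conjI ballI)
  have img: "T ` M = N" and iso: "\<And>a b. a \<in> M \<Longrightarrow> b \<in> M \<Longrightarrow> dist (T a) (T b) = dist a b"
    using assms by (auto simp: surjective_isometry_def)
  show "inv_into M T ` N = M"
    using surjective_isometry_inj[OF assms] img by (metis inv_into_image_cancel order_refl)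
  fix a b assume "a \<in> N" "b \<in> N"
  then show "dist (inv_into M T a) (inv_into M T b) = dist a b"
    using img iso by (metis f_inv_into_f inv_into_into)
qed

text \<open>If \<open>z\<close> has the property that antipodality to \<open>z\<close> implies antipodality to each
  point of \<open>Z\<close>, then one face of the ball contains \<open>-z\<close> and \<open>-Z\<close>; its point \<open>y\<close> is
  built by repeatedly replacing \<open>y\<close> with \<open>(y - w)/2\<close>.\<close>

lemma antipodal_common_face:
  fixes Z :: "'b::real_normed_vector set"
  assumes "subspace W" "finite Z" "Z \<subseteq> unit_sphere W" "z \<in> unit_sphere W"
    and "\<And>w y. w \<in> Z \<Longrightarrow> y \<in> unit_sphere W \<Longrightarrow> norm (y - z) = 2 \<Longrightarrow> norm (y - w) = 2"
  shows "\<exists>y\<in>unit_sphere W. \<forall>q. linear q \<longrightarrow> (\<forall>x. q x \<le> norm x) \<longrightarrow> q y = 1 \<longrightarrow>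
    q z = - 1 \<and> (\<forall>w\<in>Z. q w = - 1)"
  using assms(2,3,5)
proof (induction Z)
  case empty
  have "q z = - 1" if "linear q" "q (- z) = 1" for q :: "'b \<Rightarrow> real"
    using that linear_neg[OF that(1), of z] by simp
  moreover have "- z \<in> unit_sphere W"
    using assms(1,4) by (simp add: unit_sphere_def subspace_neg)
  ultimately show ?case by blast
next
  case (insert w Z)
  have "\<exists>y\<in>unit_sphere W. \<forall>q. linear q \<longrightarrow> (\<forall>x. q x \<le> norm x) \<longrightarrow> q y = 1 \<longrightarrow>
      q z = - 1 \<and> (\<forall>w\<in>Z. q w = - 1)"
    by (rule insert.IH) (use insert.prems in blast)+
  then obtain y where y: "y \<in> unit_sphere W"
    and yq: "\<And>q. linear q \<Longrightarrow> (\<And>x. q x \<le> norm x) \<Longrightarrow> q y = 1 \<Longrightarrow> q z = - 1 \<and> (\<forall>w\<in>Z. q w = - 1)"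
    by blast
  have ny: "norm y = 1" "norm z = 1" "norm w = 1" "y \<in> W" "w \<in> W"
    using y assms(4) insert.prems by (auto simp: unit_sphere_def)
  obtain q where q: "linear q" "\<And>x. q x \<le> norm x" "q y = 1"
    using convex_sphere_functional[of "{y}"] ny(1) by auto
  have "q (y - z) = 2"
    using yq[OF q] q(3) linear_diff[OF q(1), of y z] by simp
  then have "norm (y - z) = 2"
    using q(2)[of "y - z"] norm_triangle_ineq4[of y z] ny by simp
  then have nyw: "norm (y - w) = 2"
    using insert.prems(2) y by blast
  let ?y = "(1/2) *\<^sub>R (y - w)"
  have "?y \<in> unit_sphere W"
    using nyw ny assms(1) by (simp add: unit_sphere_def subspace_diff subspace_scale)
  moreover have "p z = - 1 \<and> (\<forall>w\<in>insert w Z. p w = - 1)"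
    if p: "linear p" "\<And>x. p x \<le> norm x" "p ?y = 1" for p
  proof -
    have "p y - p w = 2" using p(3) by (simp add: linear_scale[OF p(1)] linear_diff[OF p(1)])
    moreover have "p y \<le> 1" "- p w \<le> 1"
      using p(2)[of y] p(2)[of "- w"] ny linear_neg[OF p(1)] by auto
    ultimately have "p y = 1" "p w = - 1" by auto
    then show ?thesis using yq[OF p(1,2)] by simp
  qed
  ultimately show ?case by blast
qed

text \<open>Iterated midpoints: if \<open>y\<close> has distance 2 from the midpoint of
  \<open>m\<close> and \<open>x\<close>, its distances to \<open>m\<close> and \<open>x\<close> sum
  to at least 4 while each is at most 2. One point of \<open>C\<close> thus controls antipodality
  for all of \<open>I\<close>, a relation that an isometry transports.\<close>

lemma convex_antipodal_point:
  fixes C :: "'a::real_normed_vector set"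
  assumes "convex C" "finite I" "I \<noteq> {}" "I \<subseteq> C" and C: "\<And>c. c \<in> C \<Longrightarrow> norm c \<le> 1"
  shows "\<exists>m\<in>C. \<forall>x\<in>I. \<forall>y. norm y \<le> 1 \<longrightarrow> norm (y - m) = 2 \<longrightarrow> norm (y - x) = 2"
  using assms(2,3,4)
proof (induction I rule: finite_ne_induct)
  case (singleton x)
  then show ?case by auto
next
  case (insert x I)
  then obtain m where m: "m \<in> C"
    "\<And>z y. z \<in> I \<Longrightarrow> norm y \<le> 1 \<Longrightarrow> norm (y - m) = 2 \<Longrightarrow> norm (y - z) = 2" by auto
  let ?m = "(1/2) *\<^sub>R m + (1/2) *\<^sub>R x"
  have "?m \<in> C" using assms(1) m(1) insert.prems by (intro convexD) auto
  moreover have "norm (y - m) = 2 \<and> norm (y - x) = 2" if y: "norm y \<le> 1" "norm (y - ?m) = 2" for y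
  proof -
    have "(y - m) + (y - x) = 2 *\<^sub>R (y - ?m)"
      by (simp add: scaleR_diff_right scaleR_add_right scaleR_2)
    then have "norm ((y - m) + (y - x)) = 4"
      using y(2) by simp
    moreover have "norm (y - m) \<le> 2" "norm (y - x) \<le> 2"
      using norm_triangle_ineq4[of y m] norm_triangle_ineq4[of y x] C[OF m(1)] C[of x] insert.prems y
      by auto
    ultimately show ?thesis using norm_triangle_ineq[of "y - m" "y - x"] by linarith
  qed
  ultimately show ?case using m(2) by (metis insertE)
qed

text \<open>\<open>T\<close> may distort convex combinations, but their norm cannot drop below 1.
  For finitely many points of \<open>C\<close> there is \<open>m \<in> C\<close> whose antipodes are
  antipodes of all of them; \<open>T\<close> carries this over, and
  \<open>antipodal_common_face\<close> then gives a functional of norm at most 1 equal to -1 on all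
  the images, hence on their combination.\<close>

lemma spherical_isometry_convex_hull_image:
  fixes V :: "'a::real_normed_vector set" and W :: "'b::real_normed_vector set"
  assumes W: "subspace W"
    and T: "surjective_isometry (unit_sphere V) (unit_sphere W) T"
    and C: "convex C" "C \<subseteq> unit_sphere V"
  shows "convex hull (T ` C) \<subseteq> unit_sphere W"
proof
  have img: "T ` unit_sphere V = unit_sphere W"
    and iso: "\<And>a b. a \<in> unit_sphere V \<Longrightarrow> b \<in> unit_sphere V \<Longrightarrow> norm (T a - T b) = norm (a - b)"
    using T by (auto simp: surjective_isometry_def dist_norm)
  fix b assume "b \<in> convex hull (T ` C)"
  then obtain S u where S: "finite S" "S \<subseteq> T ` C" "\<forall>x\<in>S. 0 \<le> u x" "sum u S = 1"
    and b: "b = (\<Sum>v\<in>S. u v *\<^sub>R v)"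
    unfolding convex_hull_explicit by blast
  obtain I where I: "finite I" "I \<subseteq> C" "S = T ` I"
    using S(1,2) finite_subset_image by metis
  have nC: "norm c \<le> 1" if "c \<in> C" for c using that C(2) by (auto simp: unit_sphere_def)
  have "I \<noteq> {}" using S(4) I(3) by auto
  obtain m where m: "m \<in> C"
    "\<And>x y. x \<in> I \<Longrightarrow> norm y \<le> 1 \<Longrightarrow> norm (y - m) = 2 \<Longrightarrow> norm (y - x) = 2"
    using convex_antipodal_point[OF C(1) I(1) \<open>I \<noteq> {}\<close> I(2)] nC by blast
  have SW: "S \<subseteq> unit_sphere W" using S(2) C(2) img by auto
  have "\<exists>y\<in>unit_sphere W. \<forall>q. linear q \<longrightarrow> (\<forall>x. q x \<le> norm x) \<longrightarrow> q y = 1 \<longrightarrow>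
    q (T m) = - 1 \<and> (\<forall>w\<in>S. q w = - 1)"
  proof (rule antipodal_common_face[OF W S(1) SW])
    show "T m \<in> unit_sphere W" using m(1) C(2) img by auto
    fix w y assume w: "w \<in> S" and y: "y \<in> unit_sphere W" "norm (y - T m) = 2"
    obtain x where x: "x \<in> I" "w = T x" using w I(3) by auto
    obtain a where a: "a \<in> unit_sphere V" "y = T a" using y(1) img by auto
    have "norm (a - m) = 2" using y(2) a m(1) C(2) iso[of a m] by auto
    then have "norm (a - x) = 2" using m(2)[OF x(1)] a(1) by (auto simp: unit_sphere_def)
    then show "norm (y - w) = 2" using iso[of a x] a x I(2) C(2) by auto
  qed
  then obtain y where y: "y \<in> unit_sphere W" and
    yq: "\<And>q. linear q \<Longrightarrow> (\<And>x. q x \<le> norm x) \<Longrightarrow> q y = 1 \<Longrightarrow> \<forall>w\<in>S. q w = - 1"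
    by blast
  obtain q where q: "linear q" "\<And>x. q x \<le> norm x" "q y = 1"
    using convex_sphere_functional[of "{y}"] y by (auto simp: unit_sphere_def)
  have "q b = (\<Sum>v\<in>S. u v * q v)"
    unfolding b by (simp add: linear_sum[OF q(1)] linear_scale[OF q(1)])
  also have "\<dots> = (\<Sum>v\<in>S. u v * (- 1))"
    by (rule sum.cong) (use yq[OF q] in auto)
  finally have "q b = - 1" using S(4) by (simp add: sum_negf)
  then have "1 \<le> norm b" using q(2)[of "- b"] linear_neg[OF q(1)] by simp
  moreover have "norm b \<le> (\<Sum>v\<in>S. norm (u v *\<^sub>R v))" unfolding b by (rule norm_sum)
  moreover have "(\<Sum>v\<in>S. norm (u v *\<^sub>R v)) = (\<Sum>v\<in>S. u v)"
    by (rule sum.cong) (use S(3) SW in \<open>auto simp: unit_sphere_def\<close>)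
  moreover have "b \<in> W"
    unfolding b using SW W by (intro subspace_sum subspace_scale) (auto simp: unit_sphere_def)
  ultimately show "b \<in> unit_sphere W" using S(4) by (simp add: unit_sphere_def)
qed

section \<open>Weak peak sets\<close>

lemma cmod_le_1_Re_eq_1: "cmod z \<le> 1 \<Longrightarrow> Re z = 1 \<Longrightarrow> z = 1"
  using cmod_power2[of z] power_mono[of "cmod z" 1 2] by (simp add: complex_eq_iff)

text \<open>Points of the unit circle are extreme in the disc; multiplication by
  \<open>cnj c\<close> moves \<open>c\<close> to 1, where real parts decide.\<close>

lemma cmod_le_1_add_eq:
  assumes "cmod a \<le> 1" "cmod b \<le> 1" "cmod c = 1" "a + b = 2 * c"
  shows "a = c" "b = c"
proof -
  have c: "c * cnj c = 1" using assms(3) by (simp add: complex_norm_square[symmetric])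
  have le: "cmod (a * cnj c) \<le> 1" "cmod (b * cnj c) \<le> 1" using assms by (simp_all add: norm_mult)
  have "a * cnj c + b * cnj c = 2 * (c * cnj c)"
    using assms(4) by (simp add: distrib_right[symmetric])
  then have "Re (a * cnj c + b * cnj c) = 2" by (simp only: c) simp
  then have "Re (a * cnj c) + Re (b * cnj c) = 2" by (simp only: plus_complex.sel)
  moreover have "Re (a * cnj c) \<le> 1" "Re (b * cnj c) \<le> 1"
    by (rule order_trans[OF complex_Re_le_cmod], rule le)+
  ultimately have "Re (a * cnj c) = 1" "Re (b * cnj c) = 1" by linarith+
  then have *: "a * cnj c = 1" "b * cnj c = 1" using le cmod_le_1_Re_eq_1 by blast+
  have "z = z * cnj c * c" for z using c by (simp add: mult.assoc mult.commute[of "cnj c"])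
  then show "a = c" "b = c" using * by (metis mult_1)+
qed

text \<open>The hypothesis describes the disc with diameter from 0 to 1, which touches the unit
  circle only at 1. The sharp peaking functions below take their values in it.\<close>

lemma half_disc_cmod:
  assumes "cmod (2 * w - 1) \<le> 1"
  shows "cmod w \<le> 1"
proof -
  have "2 * cmod w = cmod ((2 * w - 1) + 1)" by (simp add: norm_mult)
  moreover have "cmod ((2 * w - 1) + 1) \<le> 1 + 1"
    by (rule norm_triangle_le) (use assms in simp)
  ultimately show ?thesis by linarith
qed

lemma complete_bcontfun:
  "complete (UNIV :: ('x::topological_space \<Rightarrow>\<^sub>C 'b::complete_space) set)"
  unfolding complete_def
proof (intro allI impI)
  fix f :: "nat \<Rightarrow> ('x \<Rightarrow>\<^sub>C 'b)"
  assume "(\<forall>n. f n \<in> UNIV) \<and> Cauchy f"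
  then have C: "\<exists>M. \<forall>m\<ge>M. \<forall>n\<ge>M. dist (f m) (f n) < e" if "e > 0" for e
    using that by (simp add: Cauchy_def)
  have "uniformly_Cauchy_on UNIV (\<lambda>n. apply_bcontfun (f n))"
    unfolding uniformly_Cauchy_on_def
  proof (intro allI impI)
    fix e :: real assume "e > 0"
    from C[OF this] show "\<exists>M. \<forall>x\<in>UNIV. \<forall>m\<ge>M. \<forall>n\<ge>M.
        dist (apply_bcontfun (f m) x) (apply_bcontfun (f n) x) < e"
      by (blast intro: dist_fun_lt_imp_dist_val_lt)
  qed
  then obtain g where "uniform_limit UNIV (\<lambda>n. apply_bcontfun (f n)) g sequentially"
    using Cauchy_uniformly_convergent uniformly_convergent_on_def by blast
  then obtain l where "f \<longlonglongrightarrow> l"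
    by (rule uniform_limit_bcontfunE[OF _ sequentially_bot])
  then show "\<exists>l\<in>UNIV. f \<longlonglongrightarrow> l" by blast
qed

lemma apply_bcontfun_sum: "apply_bcontfun (sum f I) x = (\<Sum>i\<in>I. apply_bcontfun (f i) x)"
  by (induction I rule: infinite_finite_induct) auto

lemma cmod_apply_le: "norm f \<le> r \<Longrightarrow> norm (apply_bcontfun f x) \<le> r"
  by (rule order_trans[OF norm_bounded])

section \<open>Uniform algebras: peaking functions and norm-controlled interpolation on weak peak
  sets\<close>

locale unif_alg =
  fixes A :: "('x::t2_space \<Rightarrow>\<^sub>C complex) set"
  assumes uniform_algebra: "uniform_algebra A"
begin

lemma compact_UNIV: "compact (UNIV :: 'x set)"
  and closed_A: "closed A"
  and subspace_A: "complex_vector.subspace A"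
  and times_mem: "f \<in> A \<Longrightarrow> g \<in> A \<Longrightarrow> f * g \<in> A"
  and const_mem: "const_bcontfun c \<in> A"
  and separates: "x \<noteq> y \<Longrightarrow> \<exists>f\<in>A. apply_bcontfun f x \<noteq> apply_bcontfun f y"
  using uniform_algebra by (auto simp: uniform_algebra_def)

lemmas add_mem = complex_vector.subspace_add[OF subspace_A]
  and diff_mem = complex_vector.subspace_diff[OF subspace_A]
  and scaleC_mem = complex_vector.subspace_scale[OF subspace_A]
  and zero_mem = complex_vector.subspace_0[OF subspace_A]
  and sum_mem = complex_vector.subspace_sum[OF subspace_A]

lemmas mem_intros = times_mem const_mem add_mem diff_mem scaleC_mem zero_mem sum_mem

lemma scaleR_mem: "f \<in> A \<Longrightarrow> r *\<^sub>R f \<in> A"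
  by (simp add: scaleR_scaleC mem_intros)

lemma complete_A: "complete A"
  using complete_closed_subset[OF closed_A subset_UNIV complete_bcontfun] .

lemma compact_closed: "closed (K :: 'x set) \<Longrightarrow> compact K"
  using compact_Int_closed[OF compact_UNIV] by simp

text \<open>The function \<open>(1 - r) / (1 - r * f)\<close> is found inside \<open>A\<close>,
  without inverting elements, as the fixed point of \<open>u \<mapsto> (1 - r) + r * f * u\<close>,
  a contraction with constant \<open>r\<close> of the complete set \<open>A\<close>.\<close>

lemma geometric_mem:
  assumes f: "f \<in> A" "norm f \<le> 1" and r: "0 \<le> r" "r < 1"
  shows "\<exists>u\<in>A. \<forall>y. apply_bcontfun u y * (1 - of_real r * apply_bcontfun f y) = 1 - of_real r"
proof -
  let ?G = "\<lambda>u. const_bcontfun (1 - of_real r) + of_real r *\<^sub>C (f * u)"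
  have "\<exists>!u\<in>A. ?G u = u"
  proof (rule Banach_fix[OF complete_A _ r])
    show "A \<noteq> {}" using zero_mem by blast
    show "?G ` A \<subseteq> A" using f(1) by (auto intro!: mem_intros)
    fix u v assume "u \<in> A" "v \<in> A"
    have "?G u - ?G v = of_real r *\<^sub>C (f * (u - v))"
      by (rule bcontfun_eqI) (simp add: scaleC_complex_def algebra_simps)
    then have "dist (?G u) (?G v) = r * norm (f * (u - v))"
      using r(1) by (simp add: dist_norm norm_scaleC)
    also have "\<dots> \<le> r * (norm f * norm (u - v))"
      by (rule mult_left_mono[OF norm_mult_ineq r(1)])
    also have "\<dots> \<le> r * (1 * norm (u - v))"
      by (intro mult_left_mono mult_right_mono f r) auto
    finally show "dist (?G u) (?G v) \<le> r * dist u v" by (simp add: dist_norm)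
  qed
  then obtain u where u: "u \<in> A" "?G u = u" by blast
  have "apply_bcontfun u y * (1 - of_real r * apply_bcontfun f y) = 1 - of_real r" for y
    using arg_cong[OF u(2), of "\<lambda>g. apply_bcontfun g y"]
    by (simp add: scaleC_complex_def algebra_simps)
  then show ?thesis using u(1) by blast
qed

text \<open>The Moebius map \<open>z \<mapsto> (1 - r) / (1 - r * z)\<close> fixes 1 and sends the
  unit disc into the disc with diameter from 0 to 1; for \<open>r\<close> close to 1 its values are
  small wherever \<open>cmod z\<close> stays away from 1.\<close>

lemma cmod_geometric_le:
  fixes w z :: complex
  assumes "cmod z \<le> 1" "0 \<le> r" "r < 1" and w: "w * (1 - of_real r * z) = 1 - of_real r"
  shows "cmod (2 * w - 1) \<le> 1" "cmod w * (1 - cmod z) \<le> 1 - r" "z = 1 \<Longrightarrow> w = 1"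
proof -
  have "cmod (of_real r * z) < 1"
    using assms mult_left_mono[of "cmod z" 1 r] by (simp add: norm_mult)
  then have nz: "1 - of_real r * z \<noteq> 0" by auto
  have "(2 * w - 1) * (1 - of_real r * z) = 1 - 2 * of_real r + of_real r * z"
    unfolding left_diff_distrib mult.assoc w by simp
  then have "cmod (2 * w - 1) * cmod (1 - of_real r * z) = cmod (1 - 2 * of_real r + of_real r * z)"
    by (simp only: norm_mult[symmetric])
  also have "\<dots> \<le> cmod (1 - of_real r * z)"
  proof (rule power2_le_imp_le)
    have "Re z \<le> 1" by (rule order_trans[OF complex_Re_le_cmod assms(1)])
    \<comment> \<open>This is exactly the difference of the two squares.\<close>
    then have "0 \<le> 4 * r * (1 - r) * (1 - Re z)" using assms by simp
    then show "(cmod (1 - 2 * of_real r + of_real r * z))\<^sup>2 \<le> (cmod (1 - of_real r * z))\<^sup>2"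
      unfolding cmod_power2 by (simp add: power2_eq_square algebra_simps)
  qed simp
  finally show "cmod (2 * w - 1) \<le> 1" using nz by simp
  have "cmod w * (1 - cmod z) \<le> cmod w * cmod (1 - of_real r * z)"
  proof (rule mult_left_mono)
    have "cmod (of_real r * z) \<le> cmod z"
      using assms mult_right_mono[of r 1 "cmod z"] by (simp add: norm_mult)
    then show "1 - cmod z \<le> cmod (1 - of_real r * z)"
      using norm_triangle_ineq2[of 1 "of_real r * z"] by simp
  qed simp
  also have "\<dots> = cmod (1 - of_real r)" 
    by (simp only: norm_mult[symmetric] w)
  also have "\<dots> = 1 - r"
    using assms(3) norm_of_real[of "1 - r", where ?'a = complex] by simp
  finally show "cmod w * (1 - cmod z) \<le> 1 - r" .
  show "w = 1" if "z = 1"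
    using w nz that by (simp only: mult_1_right mult_cancel_right1) simp
qed

lemma sharp_peak:
  assumes f: "f \<in> A" "norm f \<le> 1" and K: "closed K" "\<forall>y\<in>K. cmod (apply_bcontfun f y) < 1"
    and e: "e > 0"
  shows "\<exists>u\<in>A. (\<forall>y. cmod (2 * apply_bcontfun u y - 1) \<le> 1) \<and>
    (\<forall>y. apply_bcontfun f y = 1 \<longrightarrow> apply_bcontfun u y = 1) \<and> (\<forall>y\<in>K. cmod (apply_bcontfun u y) \<le> e)"
proof -
  have "\<exists>s. 0 \<le> s \<and> s < 1 \<and> (\<forall>y\<in>K. cmod (apply_bcontfun f y) \<le> s)"
  proof (cases "K = {}")
    case False
    have "\<exists>x\<in>K. \<forall>y\<in>K. cmod (apply_bcontfun f y) \<le> cmod (apply_bcontfun f x)"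
      by (rule continuous_attains_sup[OF compact_closed[OF K(1)] False]) (intro continuous_intros; simp)
    then show ?thesis using K(2) by (metis norm_ge_zero)
  qed (auto intro: exI[of _ 0])
  then obtain s where s: "0 \<le> s" "s < 1" "\<And>y. y \<in> K \<Longrightarrow> cmod (apply_bcontfun f y) \<le> s" by blast
  \<comment> \<open>On \<open>K\<close> the modulus of \<open>u\<close> is at most
    \<open>(1 - r) / (1 - s)\<close>, which this choice makes \<open>min e 1\<close>; the minimum
    keeps \<open>r\<close> nonnegative.\<close>
  define r where "r = 1 - min e 1 * (1 - s)"
  have "min e 1 * (1 - s) \<le> 1 * 1" using s e by (intro mult_mono) auto
  then have r: "0 \<le> r" "r < 1" using s e by (auto simp: r_def)
  obtain u where u: "u \<in> A"
    "\<And>y. apply_bcontfun u y * (1 - of_real r * apply_bcontfun f y) = 1 - of_real r"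
    using geometric_mem[OF f r] by blast
  note * = cmod_geometric_le[OF cmod_apply_le[OF f(2)] r u(2)]
  have "cmod (apply_bcontfun u y) \<le> e" if "y \<in> K" for y
  proof -
    have "cmod (apply_bcontfun u y) * (1 - s) \<le> cmod (apply_bcontfun u y) * (1 - cmod (apply_bcontfun f y))"
      by (rule mult_left_mono) (use s(3)[OF that] in auto)
    also have "\<dots> \<le> min e 1 * (1 - s)" using *(2)[of y] by (simp add: r_def)
    finally show ?thesis using s(2) by simp
  qed
  then show ?thesis using u(1) *(1,3) by blast
qed

text \<open>A nonempty intersection of peak sets, in neighbourhood form: \<open>(1 + f) / 2\<close>
  peaks exactly where \<open>f = 1\<close>, a set between \<open>E\<close> and
  \<open>U\<close>.\<close>

definition weak_peak_set :: "'x set \<Rightarrow> bool"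
  where "weak_peak_set E \<longleftrightarrow> closed E \<and> E \<noteq> {} \<and>
    (\<forall>U. open U \<longrightarrow> E \<subseteq> U \<longrightarrow> (\<exists>f\<in>A. norm f \<le> 1 \<and> (\<forall>y\<in>E. apply_bcontfun f y = 1) \<and>
      (\<forall>y. y \<notin> U \<longrightarrow> cmod (apply_bcontfun f y) < 1)))"

lemma weak_peak_setD:
  assumes "weak_peak_set E" "open U" "E \<subseteq> U"
  shows "\<exists>f\<in>A. norm f \<le> 1 \<and> (\<forall>y\<in>E. apply_bcontfun f y = 1) \<and>
    (\<forall>y. y \<notin> U \<longrightarrow> cmod (apply_bcontfun f y) < 1)"
  using assms(1)[unfolded weak_peak_set_def, THEN conjunct2, THEN conjunct2, THEN spec, THEN mp,
    OF assms(2), THEN mp, OF assms(3)] .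

lemma weak_peak_set_sharp:
  assumes E: "weak_peak_set E" "open U" "E \<subseteq> U" and e: "e > 0"
  shows "\<exists>u\<in>A. (\<forall>y. cmod (2 * apply_bcontfun u y - 1) \<le> 1) \<and>
    (\<forall>y\<in>E. apply_bcontfun u y = 1) \<and> (\<forall>y. y \<notin> U \<longrightarrow> cmod (apply_bcontfun u y) \<le> e)"
proof -
  obtain f where f: "f \<in> A" "norm f \<le> 1" "\<forall>y\<in>E. apply_bcontfun f y = 1"
    "\<forall>y. y \<notin> U \<longrightarrow> cmod (apply_bcontfun f y) < 1"
    using weak_peak_setD[OF E] by blast
  have "closed (- U)" "\<forall>y\<in>- U. cmod (apply_bcontfun f y) < 1"
    using E(2) f(4) by auto
  from sharp_peak[OF f(1,2) this e] obtain u where "u \<in> A"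
    "\<forall>y. cmod (2 * apply_bcontfun u y - 1) \<le> 1"
    "\<forall>y. apply_bcontfun f y = 1 \<longrightarrow> apply_bcontfun u y = 1"
    "\<forall>y\<in>- U. cmod (apply_bcontfun u y) \<le> e"
    by (elim bexE conjE)
  then show ?thesis using f(3) by (intro bexI[of _ u]) simp_all
qed

text \<open>The factor \<open>f n\<close> damps \<open>a\<close> where \<open>\<bar>a\<bar> \<ge> 1 + 2\<^sup>-\<^sup>n/4\<close>, so in the average
  \<open>\<Sum> 2\<^sup>-\<^sup>n\<^sup>-\<^sup>1 f n a\<close> the excess of \<open>\<bar>a\<bar>\<close> over 1 is offset by the damped tail.\<close>

lemma weak_peak_set_extension:
  assumes E: "weak_peak_set E" and a: "a \<in> A" "\<forall>y\<in>E. cmod (apply_bcontfun a y) \<le> 1"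
  shows "\<exists>h\<in>A. norm h \<le> 1 \<and> (\<forall>y\<in>E. apply_bcontfun h y = apply_bcontfun a y)"
proof -
  \<comment> \<open>\<open>M\<close> bounds \<open>a\<close>, so a factor of modulus at most
    \<open>1 / (4 * M)\<close> brings \<open>f n * a\<close> down to 1/4; the maximum with 1 keeps
    the quotient meaningful for \<open>a = 0\<close>.\<close>
  define M where "M = max 1 (norm a)"
  have M: "M \<ge> 1" "cmod (apply_bcontfun a y) \<le> M" for y
    unfolding M_def by (auto intro: max.coboundedI2 norm_bounded)
  define U where "U n = {y. cmod (apply_bcontfun a y) < 1 + (1/2)^n / 4}" for n :: nat
  have "\<exists>f\<in>A. (\<forall>y. cmod (apply_bcontfun f y) \<le> 1) \<and> (\<forall>y\<in>E. apply_bcontfun f y = 1) \<and>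
      (\<forall>y. y \<notin> U n \<longrightarrow> cmod (apply_bcontfun f y) \<le> 1 / (4 * M))" for n
  proof -
    have "open (U n)"
      unfolding U_def by (intro open_Collect_less continuous_intros; simp)
    moreover have "cmod (apply_bcontfun a y) < 1 + (1/2)^n / 4" if "y \<in> E" for y
    proof -
      have "(1/2)^n / 4 > (0::real)" by simp
      with bspec[OF a(2) that] show ?thesis by linarith
    qed
    then have "E \<subseteq> U n" by (auto simp: U_def)
    moreover have "1 / (4 * M) > 0" using M(1) by simp
    ultimately show ?thesis
      using weak_peak_set_sharp[OF E, of "U n" "1 / (4 * M)"] half_disc_cmod by meson
  qed
  then obtain f where f: "\<And>n. f n \<in> A" "\<And>n y. cmod (apply_bcontfun (f n) y) \<le> 1"
    "\<And>n y. y \<in> E \<Longrightarrow> apply_bcontfun (f n) y = 1"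
    "\<And>n y. y \<notin> U n \<Longrightarrow> cmod (apply_bcontfun (f n) y) \<le> 1 / (4 * M)" by metis
  define F where "F n = (of_real ((1/2)^(n+1)) :: complex) *\<^sub>C (f n * a)" for n
  define S where "S n = (\<Sum>i<n. F i)" for n
  have Fy: "cmod (apply_bcontfun (F n) y) =
      (1/2)^(n+1) * cmod (apply_bcontfun (f n) y) * cmod (apply_bcontfun a y)" for n y
    by (simp add: F_def scaleC_complex_def norm_mult norm_divide norm_power)
  have Fle: "cmod (apply_bcontfun (F n) y) \<le> M * (1/2)^(n+1)" for n y
  proof -
    have "cmod (apply_bcontfun (F n) y) \<le> (1/2)^(n+1) * 1 * M"
      unfolding Fy using f(2) M by (intro mult_mono) auto
    then show ?thesis by (simp add: mult.commute)
  qed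
  have "summable (\<lambda>n. M * (1/2)^(n+1))"
    by (intro summable_mult summable_ignore_initial_segment summable_geometric) simp
  then have "uniform_limit UNIV (\<lambda>n x. \<Sum>i<n. apply_bcontfun (F i) x)
      (\<lambda>x. suminf (\<lambda>i. apply_bcontfun (F i) x)) sequentially"
    by (intro Weierstrass_m_test[where M = "\<lambda>n. M * (1/2)^(n+1)"]) (auto simp only: Fle)
  then have "uniform_limit UNIV (\<lambda>n. apply_bcontfun (S n))
      (\<lambda>x. suminf (\<lambda>i. apply_bcontfun (F i) x)) sequentially"
    by (simp add: S_def apply_bcontfun_sum[abs_def])
  then obtain h where h: "S \<longlonglongrightarrow> h"
    by (rule uniform_limit_bcontfunE[OF _ sequentially_bot])
  have SA: "S n \<in> A" for n
    unfolding S_def F_def by (intro mem_intros f a)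
  have hA: "h \<in> A"
    by (rule Lim_in_closed_set[OF closed_A _ sequentially_bot h]) (simp add: SA)
  have hy: "(\<lambda>n. apply_bcontfun (S n) y) \<longlonglongrightarrow> apply_bcontfun h y" for y
    using tendsto_uniform_limitI[OF tendsto_bcontfun_uniform_limit[OF h]] by simp
  have geo: "(\<Sum>i<n. (1/2::real)^(i+1)) = 1 - (1/2)^n" for n
    by (induction n) (simp_all add: field_simps)
  have "apply_bcontfun h y = apply_bcontfun a y" if "y \<in> E" for y
  proof -
    have "apply_bcontfun (S n) y = of_real (1 - (1/2)^n) * apply_bcontfun a y" for n
      unfolding geo[symmetric] S_def
      by (simp add: apply_bcontfun_sum F_def scaleC_complex_def f(3)[OF that] sum_distrib_right)
    moreover have "(\<lambda>n. 1 - (1/2::real)^n) \<longlonglongrightarrow> 1 - 0"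
      by (intro tendsto_intros LIMSEQ_power_zero) simp
    then have "(\<lambda>n. of_real (1 - (1/2)^n) * apply_bcontfun a y) \<longlonglongrightarrow> of_real (1 - 0) * apply_bcontfun a y"
      by (intro tendsto_mult tendsto_of_real tendsto_const)
    ultimately show ?thesis using LIMSEQ_unique[OF hy[of y]] by simp
  qed
  moreover have "cmod (apply_bcontfun (S n) y) \<le> 1" for n y
  proof -
    let ?t = "cmod (apply_bcontfun a y)"
    let ?g = "\<lambda>i. cmod (apply_bcontfun (f i) y)"
    have Sle: "cmod (apply_bcontfun (S n) y) \<le> (\<Sum>i<n. (1/2)^(i+1) * ?g i) * ?t"
      unfolding S_def apply_bcontfun_sum sum_distrib_right
      by (rule order_trans[OF norm_sum]) (simp add: Fy)
    show ?thesis
    proof (cases "?t \<le> 1")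
      case True
      have "(\<Sum>i<n. (1/2)^(i+1) * ?g i) \<le> (\<Sum>i<n. (1/2)^(i+1))"
        by (intro sum_mono mult_left_le f(2)) auto
      also have "\<dots> \<le> 1" unfolding geo by simp
      finally have "(\<Sum>i<n. (1/2)^(i+1) * ?g i) * ?t \<le> 1 * 1"
        using True by (intro mult_mono) (auto intro!: sum_nonneg)
      with Sle show ?thesis by simp
    next
      case False
      have "\<exists>n. (1/2::real)^n < 4 * (?t - 1)"
        using False by (intro real_arch_pow_inv) auto
      then have ex: "\<exists>n. (1/2)^n / 4 \<le> ?t - 1" by (auto simp: field_simps intro: less_imp_le)
      \<comment> \<open>From \<open>N\<close> on, \<open>y\<close> lies outside every
        \<open>U n\<close> and all terms are damped. With \<open>s = (1/2)^N\<close>, minimality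
        gives \<open>?t \<le> 1 + s / 2\<close> when \<open>N > 0\<close>; for \<open>N = 0\<close>
        the undamped weight \<open>1 - s\<close> vanishes. The final bound
        \<open>(1 - s) * (1 + s / 2) + s / 4\<close> equals
        \<open>1 - s / 4 - s * s / 2\<close>.\<close>
      define N where "N = (LEAST n. (1/2)^n / 4 \<le> ?t - 1)"
      have N: "(1/2)^N / 4 \<le> ?t - 1" unfolding N_def by (rule LeastI_ex[OF ex])
      define s where "s = (1/2::real)^N"
      have s: "0 < s" "s \<le> 1" by (auto simp: s_def power_le_one)
      have small: "?g (N + i) \<le> 1 / (4 * M)" for i
      proof (rule f(4))
        have "(1/2::real)^(N+i) \<le> (1/2)^N" by (intro power_decreasing) auto
        with N show "y \<notin> U (N + i)" unfolding U_def mem_Collect_eq by linarith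
      qed
      have tail: "(\<Sum>i<N+k. (1/2)^(i+1) * ?g i) \<le> (1 - s) + (s - s * (1/2)^k) / (4 * M)" for k
      proof (induction k)
        case 0
        have "(\<Sum>i<N. (1/2)^(i+1) * ?g i) \<le> (\<Sum>i<N. (1/2)^(i+1))"
          by (intro sum_mono mult_left_le f(2)) auto
        then show ?case unfolding geo by (simp add: s_def)
      next
        case (Suc k)
        have "(1/2)^(N+k+1) * ?g (N+k) \<le> (1/2)^(N+k+1) * (1 / (4 * M))"
          by (intro mult_left_mono small) auto
        also have "\<dots> = (s * (1/2)^k - s * (1/2)^Suc k) / (4 * M)"
          by (simp add: s_def power_add)
        finally show ?case using Suc by (simp add: diff_divide_distrib)
      qed
      have "(\<Sum>i<n. (1/2)^(i+1) * ?g i) \<le> (\<Sum>i<N+n. (1/2)^(i+1) * ?g i)"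
        by (intro sum_mono2) auto
      also note tail[of n]
      also have "(s - s * (1/2)^n) / (4 * M) \<le> s / (4 * M)"
        using M s by (intro divide_right_mono) auto
      finally have "(\<Sum>i<n. (1/2)^(i+1) * ?g i) \<le> (1 - s) + s / (4 * M)" by simp
      then have "(\<Sum>i<n. (1/2)^(i+1) * ?g i) * ?t \<le> ((1 - s) + s / (4 * M)) * ?t"
        by (intro mult_right_mono) auto
      also have "\<dots> = (1 - s) * ?t + s / (4 * M) * ?t" by (simp add: distrib_right)
      also have "s / (4 * M) * ?t \<le> s / (4 * M) * M"
        using M s by (intro mult_left_mono) auto
      also have "s / (4 * M) * M = s / 4" using M by simp
      also have "(1 - s) * ?t \<le> (1 - s) * (1 + s / 2)"
      proof (cases N)
        case 0
        then show ?thesis by (simp add: s_def)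
      next
        case (Suc m)
        then have "\<not> (1/2)^m / 4 \<le> ?t - 1"
          unfolding N_def using not_less_Least[of m "\<lambda>n. (1/2)^n / 4 \<le> ?t - 1"] by simp
        then have "?t \<le> 1 + s / 2" using Suc by (simp add: s_def)
        then show ?thesis using s by (intro mult_left_mono) auto
      qed
      also have "(1 - s) * (1 + s / 2) + s / 4 \<le> 1"
        using s by (simp add: algebra_simps)
      finally show ?thesis using Sle by simp
    qed
  qed
  then have "norm (S n) \<le> 1" for n by (intro norm_bound)
  then have "norm h \<le> 1" by (intro LIMSEQ_le_const2[OF tendsto_norm[OF h]]) auto
  ultimately show ?thesis using hA by blast
qed

end

section \<open>Estimates in the disc and compactness of chains\<close>

lemma cmod_one_add_less_2:
  assumes "cmod z \<le> 1" "z \<noteq> 1"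
  shows "cmod (1 + z) < 2"
proof (rule ccontr)
  assume "\<not> cmod (1 + z) < 2"
  then have "2\<^sup>2 \<le> (cmod (1 + z))\<^sup>2" by (intro power_mono) auto
  moreover have "(cmod z)\<^sup>2 \<le> 1" using assms(1) by (simp add: power_le_one)
  ultimately have "1 \<le> Re z" unfolding cmod_power2 by (simp add: power2_eq_square algebra_simps)
  moreover have "Re z \<le> 1" by (rule order_trans[OF complex_Re_le_cmod assms(1)])
  ultimately show False using cmod_le_1_Re_eq_1[OF assms(1)] assms(2) by simp
qed

lemma compact_subset_open_chain:
  assumes "compact K" "\<C> \<noteq> {}" "subset.chain \<A> \<C>" "\<And>D. D \<in> \<C> \<Longrightarrow> open D" "K \<subseteq> \<Union>\<C>"
  shows "\<exists>D\<in>\<C>. K \<subseteq> D"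
proof -
  obtain \<D> where D: "\<D> \<subseteq> \<C>" "finite \<D>" "K \<subseteq> \<Union>\<D>"
    using compactE[OF assms(1,5,4)] by metis
  show ?thesis
  proof (cases "\<D> = {}")
    case True
    then show ?thesis using D(3) assms(2) by auto
  next
    case False
    have C: "\<C> \<subseteq> \<A>" "\<forall>X\<in>\<C>. \<forall>Y\<in>\<C>. X \<subseteq> Y \<or> Y \<subseteq> X"
      using assms(3) by (simp_all add: subset_chain_def)
    have "subset.chain \<A> \<D>"
      unfolding subset_chain_def
    proof (intro conjI ballI)
      show "\<D> \<subseteq> \<A>" using C(1) D(1) by (rule order_trans[rotated])
      show "X \<subseteq> Y \<or> Y \<subseteq> X" if "X \<in> \<D>" "Y \<in> \<D>" for X Y
        using C(2)[THEN bspec, THEN bspec] subsetD[OF D(1)] that by simp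
    qed
    then have "\<Union>\<D> \<in> \<C>" using Union_in_chain[OF D(2) False] D(1) by blast
    then show ?thesis using D(3) by blast
  qed
qed

text \<open>The hypothesis on \<open>u\<close> means that the square of \<open>cmod u\<close> is at
  most \<open>Re u\<close>, so both quadratic expressions become linear in \<open>1 - Re u\<close>.
  The first bound is the room below 1 that the interpolation leaves, the second the size of an error
  \<open>(1 - u)\<^sup>2\<close>; both vanish at the same rate at the peak.\<close>

lemma cmod_interpolation_le:
  fixes u :: complex and r \<eta> :: real
  assumes u: "cmod (2 * u - 1) \<le> 1" and r: "\<bar>r\<bar> \<le> 1 - \<eta>" "0 < \<eta>" "\<eta> \<le> 1"
  shows "cmod (of_real r + of_real (1 - r) * u) \<le> 1 - \<eta> / 2 * (1 - Re u)"
    and "(cmod (1 - u))\<^sup>2 \<le> 1 - Re u"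
proof -
  have "(cmod (2 * u - 1))\<^sup>2 \<le> 1" using u by (simp add: power_le_one)
  then have N: "(Re u)\<^sup>2 + (Im u)\<^sup>2 \<le> Re u"
    unfolding cmod_power2 by (simp add: power2_eq_square algebra_simps)
  then show le: "(cmod (1 - u))\<^sup>2 \<le> 1 - Re u"
    unfolding cmod_power2 by (simp add: power2_eq_square algebra_simps)
  have Re: "Re u \<le> 1" using le zero_le_power2[of "cmod (1 - u)"] by linarith
  have Re0: "0 \<le> Re u" using N zero_le_power2[of "Re u"] zero_le_power2[of "Im u"] by linarith
  have "r\<^sup>2 \<le> (1 - \<eta>)\<^sup>2" using r power_mono[of "\<bar>r\<bar>" "1 - \<eta>" 2] by simp
  also have "\<dots> \<le> 1 - \<eta>"
    using r mult_right_le_one_le[of "1 - \<eta>" "1 - \<eta>"] by (simp add: power2_eq_square)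
  finally have r2: "\<eta> \<le> 1 - r\<^sup>2" by simp
  have "(cmod (of_real r + of_real (1 - r) * u))\<^sup>2
      = r\<^sup>2 + 2 * r * (1 - r) * Re u + (1 - r)\<^sup>2 * ((Re u)\<^sup>2 + (Im u)\<^sup>2)"
    unfolding cmod_power2 by (simp add: power2_eq_square algebra_simps)
  also have "\<dots> \<le> r\<^sup>2 + 2 * r * (1 - r) * Re u + (1 - r)\<^sup>2 * Re u"
    by (intro add_left_mono mult_left_mono N) simp
  also have "\<dots> = 1 - (1 - r\<^sup>2) * (1 - Re u)"
    by (simp add: power2_eq_square algebra_simps)
  also have "\<dots> \<le> 1 - \<eta> * (1 - Re u)"
    using mult_right_mono[OF r2, of "1 - Re u"] Re by simp
  also have "\<dots> \<le> (1 - \<eta> / 2 * (1 - Re u))\<^sup>2"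
    using zero_le_power2[of "\<eta> / 2 * (1 - Re u)"] by (simp add: power2_eq_square algebra_simps)
  finally have sq: "(cmod (of_real r + of_real (1 - r) * u))\<^sup>2 \<le> (1 - \<eta> / 2 * (1 - Re u))\<^sup>2" .
  have "\<eta> * (1 - Re u) \<le> 1 * 1" using r Re Re0 by (intro mult_mono) auto
  then have nn: "0 \<le> 1 - \<eta> / 2 * (1 - Re u)" by simp
  show "cmod (of_real r + of_real (1 - r) * u) \<le> 1 - \<eta> / 2 * (1 - Re u)"
    by (rule power2_le_imp_le[OF sq nn])
qed

text \<open>The pointwise estimates behind the distance formula: \<open>w\<close> is the value of the given
  function, \<open>u\<close> that of a peaking function, and \<open>B\<close> that of the modified function. The factor
  \<open>(1 - u)\<^sup>2\<close> makes the oscillation of \<open>w\<close> near the peak negligible compared with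
  \<open>1 - Re u\<close>.\<close>

lemma modified_value_bounds:
  fixes w u l :: complex and r \<eta> :: real
  assumes w: "cmod w \<le> 1" and l: "cmod l = 1" and r: "\<bar>r\<bar> \<le> 1" and \<eta>: "0 < \<eta>" "\<eta> \<le> 1"
    and u: "cmod (2 * u - 1) \<le> 1"
    and near: "cmod (w - of_real r * l) \<le> \<eta> / 8 \<or> cmod u \<le> \<eta> / 8"
    and B: "B = of_real (1 - \<eta>) * (w - of_real r * l) * (1 - u)\<^sup>2
      + l * (of_real ((1 - \<eta>) * r) + of_real (1 - (1 - \<eta>) * r) * u)"
  shows "cmod B \<le> 1" "cmod (w - B) \<le> 1 - r + 3 * \<eta>"
proof -
  define c where "c = of_real (1 - \<eta>) * (w - of_real r * l)"
  \<comment> \<open>The common factor \<open>1 - \<eta>\<close> in \<open>c\<close> and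
    \<open>s\<close> makes \<open>c + l * of_real s\<close> equal to
    \<open>of_real (1 - \<eta>) * w\<close>, and it gives the bound
    \<open>\<bar>s\<bar> \<le> 1 - \<eta>\<close> that the interpolation estimate requires.\<close>
  define s where "s = (1 - \<eta>) * r"
  have B': "B = c * (1 - u)\<^sup>2 + l * (of_real s + of_real (1 - s) * u)"
    unfolding B c_def s_def ..
  have "\<bar>s\<bar> = (1 - \<eta>) * \<bar>r\<bar>" using \<eta> by (simp add: s_def abs_mult)
  also have "\<dots> \<le> (1 - \<eta>) * 1" using \<eta> r by (intro mult_left_mono) auto
  finally have s: "\<bar>s\<bar> \<le> 1 - \<eta>" by simp
  have "\<eta> * r \<le> \<eta> * 1" using \<eta> r by (intro mult_left_mono) auto
  then have s_r: "1 - s \<le> 1 - r + \<eta>" by (simp add: s_def algebra_simps)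
  have s2: "0 \<le> 1 - s" "1 - s \<le> 2" using s \<eta> by auto
  have u1: "cmod u \<le> 1" by (rule half_disc_cmod[OF u])
  have c_le: "cmod c \<le> cmod (w - of_real r * l)"
  proof -
    have "cmod c = (1 - \<eta>) * cmod (w - of_real r * l)"
      unfolding c_def norm_mult norm_of_real using \<eta> by simp
    then show ?thesis using \<eta> mult_right_mono[of "1 - \<eta>" 1 "cmod (w - of_real r * l)"] by simp
  qed
  have "cmod (w - of_real r * l) \<le> 1 + 1"
    by (rule norm_triangle_le_diff) (use w l r in \<open>simp add: norm_mult\<close>)
  then have c2: "cmod c \<le> 2" using c_le by linarith
  have cu: "cmod c * cmod u \<le> \<eta> / 4"
  proof (cases "cmod u \<le> \<eta> / 8")
    case True
    have "cmod c * cmod u \<le> 2 * (\<eta> / 8)" using c2 True by (intro mult_mono) auto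
    then show ?thesis by simp
  next
    case False
    then have "cmod c \<le> \<eta> / 8" using near c_le by linarith
    then have "cmod c * cmod u \<le> (\<eta> / 8) * 1" using u1 \<eta> by (intro mult_mono) auto
    then show ?thesis using \<eta> by simp
  qed
  define d where "d = c * (u * (2 - u))"
  have "cmod d = cmod c * cmod u * cmod (2 - u)" by (simp add: d_def norm_mult)
  also have "\<dots> \<le> \<eta> / 4 * 3"
  proof (rule mult_mono[OF cu])
    show "cmod (2 - u) \<le> 3" by (rule norm_triangle_le_diff) (use u1 in simp)
  qed (use \<eta> in auto)
  finally have d: "cmod d \<le> 3 / 4 * \<eta>" by simp
  have lsu: "cmod (l * of_real (1 - s) * u) = (1 - s) * cmod u"
    unfolding norm_mult norm_of_real l using s2 by simp
  have B_eq: "B = of_real (1 - \<eta>) * w - d + l * of_real (1 - s) * u"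
    unfolding B' c_def d_def s_def power2_eq_square by (simp add: algebra_simps)
  have "w - B = of_real \<eta> * w + d - l * of_real (1 - s) * u"
    unfolding B_eq by (simp add: algebra_simps)
  also have "cmod \<dots> \<le> cmod (of_real \<eta> * w) + cmod d + cmod (l * of_real (1 - s) * u)"
    by (rule order_trans[OF norm_triangle_ineq4]) (intro add_right_mono norm_triangle_ineq)
  also have "\<dots> \<le> \<eta> + 3 / 4 * \<eta> + (1 - s)"
  proof (intro add_mono d)
    show "cmod (of_real \<eta> * w) \<le> \<eta>"
      unfolding norm_mult norm_of_real using \<eta> w mult_left_mono[OF w, of \<eta>] by simp
    show "cmod (l * of_real (1 - s) * u) \<le> 1 - s"
      unfolding lsu using mult_left_mono[OF u1 s2(1)] by simp
  qed
  finally show "cmod (w - B) \<le> 1 - r + 3 * \<eta>" using s_r \<eta> by linarith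
  show "cmod B \<le> 1"
  proof (cases "cmod u \<le> \<eta> / 8")
    case True
    have "cmod B \<le> cmod (of_real (1 - \<eta>) * w) + cmod d + cmod (l * of_real (1 - s) * u)"
      unfolding B_eq by (rule order_trans[OF norm_triangle_ineq]) (intro add_right_mono norm_triangle_ineq4)
    \<comment> \<open>Since \<open>cmod c * cmod u \<le> \<eta> / 4\<close>, the three terms add up
      to at most \<open>(1 - \<eta>) + 3 * \<eta> / 4 + \<eta> / 4 = 1\<close>; this is where the
      threshold \<open>\<eta> / 8\<close> comes from.\<close>
    also have "\<dots> \<le> (1 - \<eta>) + cmod c * cmod u * 3 + 2 * (\<eta> / 8)"
    proof (intro add_mono)
      have "\<bar>1 - \<eta>\<bar> = 1 - \<eta>" using \<eta> by simp
      then show "cmod (of_real (1 - \<eta>) * w) \<le> 1 - \<eta>"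
        unfolding norm_mult norm_of_real using \<eta> mult_left_mono[OF w, of "1 - \<eta>"] by simp
      show "cmod (l * of_real (1 - s) * u) \<le> 2 * (\<eta> / 8)"
        unfolding lsu using s2 True by (intro mult_mono) auto
      have "cmod (2 - u) \<le> 3" by (rule norm_triangle_le_diff) (use u1 in simp)
      then show "cmod d \<le> cmod c * cmod u * 3"
        by (simp add: d_def norm_mult mult_left_mono flip: mult.assoc)
    qed
    also have "\<dots> \<le> 1" using cu by linarith
    finally show ?thesis .
  next
    case False
    then have "cmod c \<le> \<eta> / 8" using near c_le by linarith
    note int = cmod_interpolation_le[OF u s \<eta>]
    have Re: "0 \<le> 1 - Re u" using int(2) zero_le_power2[of "cmod (1 - u)"] by linarith
    have "cmod B \<le> cmod (c * (1 - u)\<^sup>2) + cmod (l * (of_real s + of_real (1 - s) * u))"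
      unfolding B' by (rule norm_triangle_ineq)
    also have "cmod (l * (of_real s + of_real (1 - s) * u)) \<le> 1 - \<eta> / 2 * (1 - Re u)"
      unfolding norm_mult l using int(1) by simp
    also have "cmod (c * (1 - u)\<^sup>2) \<le> \<eta> / 8 * (1 - Re u)"
      unfolding norm_mult norm_power using \<open>cmod c \<le> \<eta> / 8\<close> int(2) \<eta> by (intro mult_mono) auto
    also have "\<eta> / 8 * (1 - Re u) \<le> \<eta> / 2 * (1 - Re u)"
      using \<eta> Re by (intro mult_right_mono) auto
    finally show ?thesis by simp
  qed
qed

section \<open>Weak peak points, convex subsets of the sphere, and distances to faces\<close>

context unif_alg
begin

text \<open>A peak set relative to \<open>E\<close> is again a weak peak set. With \<open>h\<close>
  the extension of \<open>a\<close> from \<open>E\<close> to norm at most 1,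
  \<open>(1 + h) / 2\<close> has modulus below 1 on \<open>E\<close> outside \<open>U\<close>, hence
  on a neighbourhood; where it fails to, a second factor \<open>f\<close> peaking on
  \<open>E\<close> has modulus below 1.\<close>

lemma weak_peak_set_level:
  assumes E: "weak_peak_set E" and a: "a \<in> A" "\<forall>y\<in>E. cmod (apply_bcontfun a y) \<le> 1"
    and x: "x \<in> E" "apply_bcontfun a x = 1"
  shows "weak_peak_set {y \<in> E. apply_bcontfun a y = 1}"
  unfolding weak_peak_set_def
proof (intro conjI allI impI)
  have "closed E" using E by (simp add: weak_peak_set_def)
  moreover have "closed {y. apply_bcontfun a y = 1}"
    by (intro closed_Collect_eq continuous_intros; simp)
  ultimately have "closed (E \<inter> {y. apply_bcontfun a y = 1})" by (rule closed_Int)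
  then show "closed {y \<in> E. apply_bcontfun a y = 1}" by (simp add: Collect_conj_eq)
  show "{y \<in> E. apply_bcontfun a y = 1} \<noteq> {}" using x by auto
  fix U assume U: "open U" "{y \<in> E. apply_bcontfun a y = 1} \<subseteq> U"
  obtain h where h: "h \<in> A" "norm h \<le> 1" "\<forall>y\<in>E. apply_bcontfun h y = apply_bcontfun a y"
    using weak_peak_set_extension[OF E a] by (elim bexE conjE)
  let ?W = "{y. cmod (1 + apply_bcontfun h y) < 2} \<union> U"
  have W: "open ?W"
    by (intro open_Un U(1) open_Collect_less continuous_intros; simp)
  have "E \<subseteq> ?W"
  proof
    fix y assume y: "y \<in> E"
    show "y \<in> ?W"
    proof (cases "apply_bcontfun a y = 1")
      case False
      then show ?thesis using cmod_one_add_less_2[OF bspec[OF a(2) y]] h(3) y by simp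
    qed (use y U in auto)
  qed
  from weak_peak_setD[OF E W this] obtain f where f: "f \<in> A" "norm f \<le> 1"
    "\<forall>y\<in>E. apply_bcontfun f y = 1" "\<forall>y. y \<notin> ?W \<longrightarrow> cmod (apply_bcontfun f y) < 1"
    by (elim bexE conjE)
  let ?k = "(1/2) *\<^sub>C (const_bcontfun 1 + h)"
  have k: "apply_bcontfun ?k y = (1 + apply_bcontfun h y) / 2" for y
    by (simp add: scaleC_complex_def)
  have k1: "cmod (apply_bcontfun ?k y) \<le> 1" for y
  proof -
    have "cmod (1 + apply_bcontfun h y) \<le> 1 + 1"
      by (rule norm_triangle_le) (use cmod_apply_le[OF h(2), of y] in simp)
    then show ?thesis unfolding k by (simp add: norm_divide)
  qed
  show "\<exists>g\<in>A. norm g \<le> 1 \<and> (\<forall>y\<in>{y \<in> E. apply_bcontfun a y = 1}. apply_bcontfun g y = 1) \<and>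
      (\<forall>y. y \<notin> U \<longrightarrow> cmod (apply_bcontfun g y) < 1)"
  proof (intro bexI conjI ballI allI impI)
    show "f * ?k \<in> A" by (intro mem_intros f h)
    show "norm (f * ?k) \<le> 1"
      using cmod_apply_le[OF f(2)] k1 by (intro norm_bound) (simp add: norm_mult mult_le_one del: apply_bcontfun_scaleC plus_bcontfun.rep_eq)
    show "apply_bcontfun (f * ?k) y = 1" if "y \<in> {y \<in> E. apply_bcontfun a y = 1}" for y
      using that f(3) h(3) k[of y] by simp
    fix y assume y: "y \<notin> U"
    have f1: "cmod (apply_bcontfun f y) \<le> 1" using cmod_apply_le[OF f(2)] .
    have eq: "cmod (apply_bcontfun (f * ?k) y) = cmod (apply_bcontfun f y) * cmod (apply_bcontfun ?k y)"
      unfolding apply_bcontfun_times norm_mult ..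
    show "cmod (apply_bcontfun (f * ?k) y) < 1"
    proof (cases "y \<in> ?W")
      case True
      then have "cmod (apply_bcontfun ?k y) < 1" using y unfolding k by (simp add: norm_divide)
      then show ?thesis unfolding eq
        using mult_right_mono[OF f1, of "cmod (apply_bcontfun ?k y)"] by simp
    next
      case False
      then have "cmod (apply_bcontfun f y) < 1" using f(4) by blast
      then show ?thesis unfolding eq
        using mult_left_mono[OF k1[of y], of "cmod (apply_bcontfun f y)"] by simp
    qed
  qed
qed

text \<open>Complements are used because Zorn's lemma for sets yields maximal elements, and a chain
  of open sets covering a compact set has a member that covers it.\<close>

lemma weak_peak_set_Inter_chain:
  assumes "\<C> \<noteq> {}" "subset.chain {U. weak_peak_set (- U) \<and> - U \<subseteq> E} \<C>"
  shows "weak_peak_set (- \<Union>\<C>)"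
  unfolding weak_peak_set_def
proof (intro conjI allI impI)
  have C: "weak_peak_set (- D)" if "D \<in> \<C>" for D
    using assms(2) that by (auto simp: subset_chain_def)
  then have op: "open D" if "D \<in> \<C>" for D
    using that by (simp add: weak_peak_set_def open_closed)
  note sub = compact_subset_open_chain[OF _ assms op]
  show "closed (- \<Union>\<C>)" using op by (auto simp: closed_def)
  show "- \<Union>\<C> \<noteq> {}"
  proof
    assume "- \<Union>\<C> = {}"
    then have "\<exists>D\<in>\<C>. UNIV \<subseteq> D" by (intro sub compact_UNIV) auto
    then obtain D where "D \<in> \<C>" "- D = {}" by blast
    then show False using C[of D] by (simp add: weak_peak_set_def)
  qed
  fix U :: "'x set" assume U: "open U" "- \<Union>\<C> \<subseteq> U"
  have "\<exists>D\<in>\<C>. - U \<subseteq> D" by (rule sub[OF compact_closed]) (use U in auto)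
  then obtain D where D: "D \<in> \<C>" "- D \<subseteq> U" by blast
  from weak_peak_setD[OF C[OF D(1)] U(1) D(2)] obtain f where f: "f \<in> A" "norm f \<le> 1"
    "\<forall>y\<in>- D. apply_bcontfun f y = 1" "\<forall>y. y \<notin> U \<longrightarrow> cmod (apply_bcontfun f y) < 1"
    by (elim bexE conjE)
  then show "\<exists>f\<in>A. norm f \<le> 1 \<and> (\<forall>y\<in>- \<Union>\<C>. apply_bcontfun f y = 1) \<and>
      (\<forall>y. y \<notin> U \<longrightarrow> cmod (apply_bcontfun f y) < 1)"
    using D(1) by (intro bexI[OF _ f(1)]) auto
qed

text \<open>A minimal weak peak set inside \<open>E\<close> is a single point: a function separating
  two of its points, divided by its value of largest modulus on the set, would have a level set at 1
  that is a strictly smaller weak peak set.\<close>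

lemma weak_peak_set_contains_point:
  assumes E: "weak_peak_set E"
  shows "\<exists>x\<in>E. weak_peak_set {x}"
proof -
  let ?A = "{U. weak_peak_set (- U) \<and> - U \<subseteq> E}"
  have "\<exists>M\<in>?A. \<forall>X\<in>?A. M \<subseteq> X \<longrightarrow> X = M"
  proof (rule subset_Zorn_nonempty)
    have "- E \<in> ?A" using E by simp
    then show "?A \<noteq> {}" by blast
    fix \<C> assume C: "\<C> \<noteq> {}" "subset.chain ?A \<C>"
    then show "\<Union>\<C> \<in> ?A"
      using weak_peak_set_Inter_chain[OF C] by (auto simp: subset_chain_def)
  qed
  then obtain M where MA: "M \<in> ?A" and Mmin: "\<forall>X\<in>?A. M \<subseteq> X \<longrightarrow> X = M"
    by (elim bexE)
  have M: "weak_peak_set (- M)" "- M \<subseteq> E" using MA by simp_all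
  have min: "X = M" if "weak_peak_set (- X)" "- X \<subseteq> E" "M \<subseteq> X" for X
    using Mmin that by simp
  let ?F = "- M"
  have F: "closed ?F" "?F \<noteq> {}" using M(1) by (simp_all add: weak_peak_set_def)
  have "z = w" if zw: "z \<in> ?F" "w \<in> ?F" for z w
  proof (rule ccontr)
    assume "z \<noteq> w"
    then obtain f where f: "f \<in> A" "apply_bcontfun f z \<noteq> apply_bcontfun f w"
      using separates by blast
    have "\<exists>p\<in>?F. \<forall>y\<in>?F. cmod (apply_bcontfun f y) \<le> cmod (apply_bcontfun f p)"
      by (rule continuous_attains_sup[OF compact_closed[OF F(1)] F(2)]) (intro continuous_intros; simp)
    then obtain p where p: "p \<in> ?F" "\<And>y. y \<in> ?F \<Longrightarrow> cmod (apply_bcontfun f y) \<le> cmod (apply_bcontfun f p)"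
      by blast
    have nz: "apply_bcontfun f p \<noteq> 0" using p(2)[OF zw(1)] p(2)[OF zw(2)] f(2) by auto
    let ?a = "inverse (apply_bcontfun f p) *\<^sub>C f"
    have a: "apply_bcontfun ?a y = apply_bcontfun f y / apply_bcontfun f p" for y
      by (simp add: scaleC_complex_def divide_inverse mult.commute)
    have "weak_peak_set {y \<in> ?F. apply_bcontfun ?a y = 1}"
    proof (rule weak_peak_set_level[OF M(1) _ _ p(1)])
      show "?a \<in> A" by (intro mem_intros f)
      show "\<forall>y\<in>?F. cmod (apply_bcontfun ?a y) \<le> 1"
        using p(2) nz unfolding a by (simp add: norm_divide)
      show "apply_bcontfun ?a p = 1" using nz unfolding a by simp
    qed
    then have "- {y \<in> ?F. apply_bcontfun ?a y = 1} = M"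
      using M(2) by (intro min) auto
    then have "{y \<in> ?F. apply_bcontfun ?a y = 1} = ?F" by blast
    then have "apply_bcontfun ?a z = 1" "apply_bcontfun ?a w = 1" using zw by auto
    then show False using f(2) nz unfolding a by simp
  qed
  then have "\<exists>x. ?F = {x}" using F(2) by blast
  then show ?thesis using M by auto
qed

lemma norm_attained: "\<exists>y. cmod (apply_bcontfun f y) = norm f" for f :: "'x \<Rightarrow>\<^sub>C complex"
proof -
  have "\<exists>p\<in>UNIV. \<forall>y\<in>UNIV. cmod (apply_bcontfun f y) \<le> cmod (apply_bcontfun f p)"
    by (rule continuous_attains_sup[OF compact_UNIV UNIV_not_empty]) (intro continuous_intros; simp)
  then obtain p where "\<And>y. cmod (apply_bcontfun f y) \<le> cmod (apply_bcontfun f p)" by auto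
  then have "norm f \<le> cmod (apply_bcontfun f p)" by (intro norm_bound)
  then show ?thesis using norm_bounded[of f p] by (intro exI[of _ p]) simp
qed

text \<open>The midpoint argument with values in place of distances: an average of numbers in the
  disc is unimodular only if they all coincide.\<close>

lemma convex_common_value:
  assumes G: "convex G" "\<forall>g\<in>G. norm g \<le> 1"
    and I: "finite I" "I \<noteq> {}" "I \<subseteq> G"
  shows "\<exists>m\<in>G. \<forall>y c. cmod c = 1 \<longrightarrow> apply_bcontfun m y = c \<longrightarrow>
    (\<forall>g\<in>I. apply_bcontfun g y = (c :: complex))"
  using I
proof (induction I rule: finite_ne_induct)
  case (singleton x)
  then show ?case by auto
next
  case (insert g I)
  then obtain m where m: "m \<in> G" "\<And>y c. cmod c = 1 \<Longrightarrow> apply_bcontfun m y = c \<Longrightarrow>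
    \<forall>g\<in>I. apply_bcontfun g y = c" by auto
  let ?m = "(1/2) *\<^sub>R m + (1/2) *\<^sub>R g"
  have gG: "g \<in> G" using insert.prems by simp
  have "?m \<in> G" using G(1) m(1) gG by (intro convexD) auto
  moreover have "\<forall>f\<in>insert g I. apply_bcontfun f y = c"
    if "cmod c = 1" "apply_bcontfun ?m y = c" for y c
  proof -
    have "apply_bcontfun m y + apply_bcontfun g y = 2 * c"
      using that(2) by (auto simp: scaleR_conv_of_real field_simps)
    note * = cmod_le_1_add_eq[OF cmod_apply_le[OF bspec[OF G(2) m(1)]] cmod_apply_le[OF bspec[OF G(2) gG]] that(1) this]
    then show ?thesis using m(2)[OF that(1) *(1)] by simp
  qed
  ultimately show ?case by blast
qed

text \<open>Averages of finitely many members of \<open>G\<close> lie in \<open>G\<close>, so they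
  attain norm 1, and there all these members agree. Compactness yields a point common to all of
  \<open>G\<close>; the set of all points with the same common value is a weak peak set, so it
  contains a weak peak point.\<close>

lemma convex_subset_face:
  assumes G: "convex G" "G \<subseteq> unit_sphere A" "G \<noteq> {}"
  shows "\<exists>x c. weak_peak_set {x} \<and> cmod c = 1 \<and> (\<forall>g\<in>G. apply_bcontfun g x = c)"
proof -
  have G1: "norm g = 1" "g \<in> A" if "g \<in> G" for g using G(2) that by (auto simp: unit_sphere_def)
  have G2: "norm g \<le> 1" if "g \<in> G" for g using G1(1)[OF that] by simp
  then have "\<forall>g\<in>G. norm g \<le> 1" by simp
  note common = convex_common_value[OF G(1) this]
  obtain g0 where g0: "g0 \<in> G" using G(3) by blast
  \<comment> \<open>The common value is not known in advance and may differ between finite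
    subfamilies, so all members are compared with one fixed \<open>g0\<close>.\<close>
  let ?P = "\<lambda>g. {y. apply_bcontfun g y = apply_bcontfun g0 y} \<inter> {y. cmod (apply_bcontfun g0 y) = 1}"
  have "UNIV \<inter> (\<Inter>g\<in>G. ?P g) \<noteq> {}"
  proof (rule compact_imp_fip_image[OF compact_UNIV])
    show "closed (?P g)" if "g \<in> G" for g
      by (intro closed_Int closed_Collect_eq continuous_intros; simp)
    fix I assume I: "finite I" "I \<subseteq> G"
    then obtain m where m: "m \<in> G" "\<And>y c. cmod c = 1 \<Longrightarrow> apply_bcontfun m y = c \<Longrightarrow>
        \<forall>g\<in>insert g0 I. apply_bcontfun g y = c"
      using common[of "insert g0 I"] g0 by auto
    obtain y where y: "cmod (apply_bcontfun m y) = 1"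
      using norm_attained[of m] G1(1)[OF m(1)] by auto
    have "y \<in> UNIV \<inter> (\<Inter>g\<in>I. ?P g)" using m(2)[OF y refl] y by auto
    then show "UNIV \<inter> (\<Inter>g\<in>I. ?P g) \<noteq> {}" by blast
  qed
  then obtain z where z: "\<And>g. g \<in> G \<Longrightarrow> z \<in> ?P g" by blast
  define c where "c = apply_bcontfun g0 z"
  have c: "cmod c = 1" "g \<in> G \<Longrightarrow> apply_bcontfun g z = c" for g
    using z[OF g0] z[of g] by (auto simp: c_def)
  have cc: "cnj c * c = 1" using c(1) by (simp add: mult.commute complex_norm_square[symmetric])
  let ?E = "\<Inter>g\<in>G. {y. apply_bcontfun g y = c}"
  have "weak_peak_set ?E"
    unfolding weak_peak_set_def
  proof (intro conjI allI impI)
    show "closed ?E"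
      by (intro closed_INT ballI closed_Collect_eq continuous_intros; simp)
    show "?E \<noteq> {}" using c(2) by blast
    fix U assume U: "open U" "?E \<subseteq> U"
    have cU: "compact (- U)" using U(1) by (intro compact_closed) auto
    have op: "open {y. apply_bcontfun g y \<noteq> c}" for g :: "'x \<Rightarrow>\<^sub>C complex"
      by (intro open_Collect_neq continuous_intros; simp)
    have cover: "- U \<subseteq> (\<Union>g\<in>G. {y. apply_bcontfun g y \<noteq> c})" using U(2) by auto
    obtain I where I: "I \<subseteq> G" "finite I" "- U \<subseteq> (\<Union>g\<in>I. {y. apply_bcontfun g y \<noteq> c})"
      by (rule compactE_image[where f = "\<lambda>g. {y. apply_bcontfun g y \<noteq> c}", OF cU op cover]) (rule that)
    have "finite (insert g0 I)" "insert g0 I \<noteq> {}" "insert g0 I \<subseteq> G" using I(1,2) g0 by auto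
    from common[OF this] obtain m where m: "m \<in> G" "\<forall>y c. cmod c = 1 \<longrightarrow> apply_bcontfun m y = c \<longrightarrow>
        (\<forall>g\<in>insert g0 I. apply_bcontfun g y = c)"
      by (elim bexE)
    \<comment> \<open>Averaging with 1 leaves modulus 1 only where \<open>m\<close> equals
      \<open>c\<close>, hence only where all of \<open>I\<close> equal \<open>c\<close>, which fails
      everywhere outside \<open>U\<close>.\<close>
    let ?f = "(1/2) *\<^sub>C (const_bcontfun 1 + cnj c *\<^sub>C m)"
    have f: "apply_bcontfun ?f y = (1 + cnj c * apply_bcontfun m y) / 2" for y
      by (simp add: scaleC_complex_def)
    have m1: "cmod (cnj c * apply_bcontfun m y) \<le> 1" for y
      using cmod_apply_le[OF G2[OF m(1)]] c(1) by (simp add: norm_mult)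
    have f1: "cmod (apply_bcontfun ?f y) \<le> 1" for y
    proof -
      have "cmod (1 + cnj c * apply_bcontfun m y) \<le> 1 + 1"
        by (rule norm_triangle_le) (use m1 in simp)
      then show ?thesis unfolding f by (simp add: norm_divide)
    qed
    show "\<exists>f\<in>A. norm f \<le> 1 \<and> (\<forall>y\<in>?E. apply_bcontfun f y = 1) \<and>
        (\<forall>y. y \<notin> U \<longrightarrow> cmod (apply_bcontfun f y) < 1)"
    proof (intro bexI conjI ballI allI impI)
      show "?f \<in> A" by (intro mem_intros G1 m)
      show "norm ?f \<le> 1" using f1 by (rule norm_bound)
      show "apply_bcontfun ?f y = 1" if "y \<in> ?E" for y
        using that m(1) cc unfolding f by auto
      fix y assume "y \<notin> U"
      then obtain g where "g \<in> I" "apply_bcontfun g y \<noteq> c" using I(3) by blast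
      then have mc: "apply_bcontfun m y \<noteq> c" using m(2)[rule_format, OF c(1), of y] by auto
      have "cnj c * apply_bcontfun m y \<noteq> 1"
      proof
        assume "cnj c * apply_bcontfun m y = 1"
        then have "(cnj c * c) * apply_bcontfun m y = c" by (simp add: mult.assoc mult.left_commute)
        then show False using mc unfolding cc by simp
      qed
      then show "cmod (apply_bcontfun ?f y) < 1"
        using cmod_one_add_less_2[OF m1[of y]] unfolding f by (simp add: norm_divide)
    qed
  qed
  from weak_peak_set_contains_point[OF this] c(1) show ?thesis by auto
qed

text \<open>The pointwise modification is a polynomial in \<open>a\<close> and a function peaking at
  \<open>x\<close>, so it stays in \<open>A\<close>. Negative \<open>r\<close> is allowed: one
  function then yields estimates for both opposite faces.\<close>

lemma face_distance:
  assumes x: "weak_peak_set {x}" and a: "a \<in> A" "norm a \<le> 1"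
    and l: "cmod l = 1" and r: "\<bar>r\<bar> \<le> 1" "apply_bcontfun a x = of_real r * l" and e: "e > 0"
  shows "\<exists>b\<in>unit_sphere A. apply_bcontfun b x = l \<and> norm (a - b) \<le> 1 - r + e"
proof -
  \<comment> \<open>The pointwise bound exceeds \<open>1 - r\<close> by
    \<open>3 * \<eta>\<close>.\<close>
  define \<eta> where "\<eta> = min (e / 3) 1"
  have \<eta>: "0 < \<eta>" "\<eta> \<le> 1" "3 * \<eta> \<le> e" using e by (auto simp: \<eta>_def)
  let ?U = "{y. cmod (apply_bcontfun a y - of_real r * l) < \<eta> / 8}"
  have U: "open ?U" by (intro open_Collect_less continuous_intros; simp)
  have "{x} \<subseteq> ?U" using r(2) \<eta> by simp
  from weak_peak_set_sharp[OF x U this, of "\<eta> / 8"] \<eta>(1) obtain u where u: "u \<in> A"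
    "\<forall>y. cmod (2 * apply_bcontfun u y - 1) \<le> 1" "apply_bcontfun u x = 1"
    "\<forall>y. y \<notin> ?U \<longrightarrow> cmod (apply_bcontfun u y) \<le> \<eta> / 8"
    by auto
  let ?v = "const_bcontfun 1 - u"
  let ?b = "of_real (1 - \<eta>) *\<^sub>C (a - const_bcontfun (of_real r * l)) * (?v * ?v)
      + l *\<^sub>C (const_bcontfun (of_real ((1 - \<eta>) * r)) + of_real (1 - (1 - \<eta>) * r) *\<^sub>C u)"
  have b: "apply_bcontfun ?b y = of_real (1 - \<eta>) * (apply_bcontfun a y - of_real r * l) * (1 - apply_bcontfun u y)\<^sup>2
      + l * (of_real ((1 - \<eta>) * r) + of_real (1 - (1 - \<eta>) * r) * apply_bcontfun u y)" for y
    by (simp add: scaleC_complex_def power2_eq_square)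
  have near: "cmod (apply_bcontfun a y - of_real r * l) \<le> \<eta> / 8 \<or> cmod (apply_bcontfun u y) \<le> \<eta> / 8" for y
    using u(4)[rule_format, of y] by (cases "y \<in> ?U") auto
  note bounds = modified_value_bounds[OF cmod_apply_le[OF a(2)] l r(1) \<eta>(1,2) u(2)[rule_format] near b]
  have bx: "apply_bcontfun ?b x = l" unfolding b u(3) by (simp add: algebra_simps)
  have "norm ?b \<le> 1" using bounds(1) by (rule norm_bound)
  moreover have "1 \<le> norm ?b" using norm_bounded[of ?b x] unfolding bx l .
  moreover have "?b \<in> A" by (intro mem_intros a u)
  ultimately have "?b \<in> unit_sphere A" by (simp add: unit_sphere_def)
  moreover have "norm (a - ?b) \<le> 1 - r + e"
  proof (rule norm_bound)
    fix y
    have "apply_bcontfun (a - ?b) y = apply_bcontfun a y - apply_bcontfun ?b y" by (simp only: minus_bcontfun.rep_eq)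
    then show "cmod (apply_bcontfun (a - ?b) y) \<le> 1 - r + e" using bounds(2)[of y] \<eta>(3) by simp
  qed
  ultimately show ?thesis using bx by blast
qed

end

section \<open>Faces and their images\<close>

lemma complex_subspace_imp_subspace:
  "complex_vector.subspace V \<Longrightarrow> subspace V"
  by (auto simp: complex_vector.subspace_def subspace_def scaleR_scaleC)

lemma cmod_diff_square_unit:
  assumes "cmod z = 1" "cmod w = 1"
  shows "(cmod (z - w))\<^sup>2 = 2 - 2 * Re (z * cnj w)"
proof -
  have "(Re z)\<^sup>2 + (Im z)\<^sup>2 = 1" "(Re w)\<^sup>2 + (Im w)\<^sup>2 = 1"
    using assms by (simp_all flip: cmod_power2)
  then show ?thesis unfolding cmod_power2 by (simp add: power2_eq_square algebra_simps)
qed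

text \<open>On the circle distances determine the inner products \<open>Re (z * cnj w)\<close>.
  Pairing with 1 fixes the real part, pairing with \<open>\<i>\<close> the imaginary part up to the
  sign of \<open>Im (\<tau> \<i>)\<close>.\<close>

lemma circle_isometry_cases:
  fixes \<tau> :: "complex \<Rightarrow> complex"
  assumes unit: "\<And>z. cmod z = 1 \<Longrightarrow> cmod (\<tau> z) = 1"
    and iso: "\<And>z w. cmod z = 1 \<Longrightarrow> cmod w = 1 \<Longrightarrow> cmod (\<tau> z - \<tau> w) = cmod (z - w)"
    and one: "\<tau> 1 = 1"
  shows "(\<forall>z. cmod z = 1 \<longrightarrow> \<tau> z = z) \<or> (\<forall>z. cmod z = 1 \<longrightarrow> \<tau> z = cnj z)"
proof -
  have prod: "Re (\<tau> z * cnj (\<tau> w)) = Re (z * cnj w)" if zw: "cmod z = 1" "cmod w = 1" for z w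
    using cmod_diff_square_unit[OF unit[OF zw(1)] unit[OF zw(2)]] cmod_diff_square_unit[OF zw]
    unfolding iso[OF zw] by linarith
  have Re: "Re (\<tau> z) = Re z" if "cmod z = 1" for z
    using prod[OF that, of 1] one by simp
  have "(Re (\<tau> \<i>))\<^sup>2 + (Im (\<tau> \<i>))\<^sup>2 = 1"
    using unit[of \<i>] cmod_power2[of "\<tau> \<i>"] by simp
  then have Im_i: "Im (\<tau> \<i>) = 1 \<or> Im (\<tau> \<i>) = - 1"
    using Re[of \<i>] by (simp add: power2_eq_1_iff)
  have Im: "Im (\<tau> z) * Im (\<tau> \<i>) = Im z" if "cmod z = 1" for z
    using prod[OF that, of \<i>] Re[of \<i>] by simp
  from Im_i show ?thesis
  proof
    assume "Im (\<tau> \<i>) = 1"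
    then have "\<forall>z. cmod z = 1 \<longrightarrow> \<tau> z = z"
      using Re Im by (simp add: complex_eq_iff)
    then show ?thesis ..
  next
    assume i: "Im (\<tau> \<i>) = - 1"
    have "\<tau> z = cnj z" if "cmod z = 1" for z
      using Re[OF that] Im[OF that] i by (simp add: complex_eq_iff)
    then show ?thesis by blast
  qed
qed

text \<open>The centres \<open>c\<close> and \<open>- c\<close> are 2 apart, which is the sum of the
  radii, so the discs have at most one common point.\<close>

lemma tangent_discs_meet:
  assumes "cmod (z - c) \<le> 1 - r" "cmod (z + c) \<le> 1 + r" "cmod c = 1"
  shows "z = of_real r * c"
proof -
  define w where "w = z * cnj c"
  have c: "cnj c * c = 1" using assms(3) by (simp add: mult.commute complex_norm_square[symmetric])
  have z: "z = w * c" using c by (simp add: w_def mult.assoc)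
  have le: "cmod (w - 1) \<le> 1 - r" "cmod (w + 1) \<le> 1 + r"
  proof -
    have "z - c = (w - 1) * c" "z + c = (w + 1) * c" by (simp_all add: z algebra_simps)
    then show "cmod (w - 1) \<le> 1 - r" "cmod (w + 1) \<le> 1 + r"
      using assms by (simp_all add: norm_mult)
  qed
  have "Re w \<le> r" using complex_Re_le_cmod[of "w + 1"] le(2) by simp
  moreover have "r \<le> Re w"
    using complex_Re_le_cmod[of "1 - w"] le(1) by (simp add: norm_minus_commute)
  ultimately have Re: "Re w = r" by simp
  have "(cmod (w - 1))\<^sup>2 \<le> (1 - r)\<^sup>2" using le(1) by (intro power_mono) auto
  then have "(Im w)\<^sup>2 \<le> 0" unfolding cmod_power2 by (simp add: Re power2_eq_square algebra_simps)
  then have "w = of_real r" using Re by (simp add: complex_eq_iff)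
  then show ?thesis using z by simp
qed

text \<open>\<open>cmod (1 - d) < 1\<close> requires an angle below pi/3. One principal square root
  only guarantees pi/2; two of them guarantee pi/4.\<close>

lemma fourth_root_near_1:
  assumes "cmod c = 1"
  shows "\<exists>d. cmod d = 1 \<and> cmod (1 - d) < 1 \<and> c = d * d * (d * d)"
proof -
  define w where "w = csqrt c"
  define d where "d = csqrt w"
  have wd: "w * w = c" "d * d = w"
    by (simp_all add: w_def d_def flip: power2_eq_square)
  have w1: "cmod w = 1" using assms by (simp add: w_def)
  have d1: "cmod d = 1" using w1 by (simp add: d_def)
  have "(Re d)\<^sup>2 + (Im d)\<^sup>2 = 1" using d1 by (simp flip: cmod_power2)
  moreover have "0 \<le> Re (csqrt z)" for z
    using csqrt_principal[of z] by (elim disjE conjE) linarith+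
  then have "0 \<le> Re w" "0 \<le> Re d" unfolding w_def d_def by blast+
  moreover have "Re w = (Re d)\<^sup>2 - (Im d)\<^sup>2" by (simp add: wd(2)[symmetric] power2_eq_square)
  ultimately have d2: "1/2 \<le> (Re d)\<^sup>2" "0 \<le> Re d" by linarith+
  have "1/2 < Re d"
  proof (rule ccontr)
    assume "\<not> 1/2 < Re d"
    then have "(Re d)\<^sup>2 \<le> (1/2)\<^sup>2" using d2(2) by (intro power_mono) auto
    then show False using d2(1) by (simp add: power2_eq_square)
  qed
  then have "(cmod (1 - d))\<^sup>2 < 1\<^sup>2" using cmod_diff_square_unit[of 1 d] d1 by simp
  then have "cmod (1 - d) < 1" by (rule power2_less_imp_less) simp
  then show ?thesis using d1 wd by metis
qed

lemma unit_times_eq_cmod: "\<exists>c. cmod c = 1 \<and> c * z = of_real (cmod z)"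
proof (cases "z = 0")
  case True
  then show ?thesis by (intro exI[of _ 1]) simp
next
  case False
  then have "cnj z / of_real (cmod z) * z = of_real (cmod z)"
    by (simp add: divide_simps mult.commute[of "cnj z"] power2_eq_square flip: complex_norm_square)
  then show ?thesis
    using False by (intro exI[of _ "cnj z / of_real (cmod z)"]) (simp add: norm_divide)
qed

lemma complexify_functional:
  fixes p :: "'b::complex_normed_vector \<Rightarrow> real"
  assumes p: "linear p" "\<And>b. p b \<le> norm b"
  shows "\<exists>q. linear q \<and> (\<forall>c b. q (c *\<^sub>C b) = c * q b) \<and> (\<forall>b. cmod (q b) \<le> norm b) \<and> (\<forall>b. Re (q b) = p b)"
proof (intro exI conjI allI)
  let ?q = "\<lambda>b. Complex (p b) (- p (\<i> *\<^sub>C b))"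
  have c_eq: "c = of_real (Re c) + of_real (Im c) * \<i>" for c by (simp add: complex_eq_iff)
  have pC: "p (c *\<^sub>C b) = Re c * p b + Im c * p (\<i> *\<^sub>C b)" for c b
  proof -
    have "c *\<^sub>C b = of_real (Re c) *\<^sub>C b + of_real (Im c) *\<^sub>C (\<i> *\<^sub>C b)"
      by (subst c_eq[of c], subst complex_vector.scale_left_distrib) simp
    also have "\<dots> = Re c *\<^sub>R b + Im c *\<^sub>R (\<i> *\<^sub>C b)"
      by (simp only: scaleR_scaleC)
    finally show ?thesis by (simp add: linear_add[OF p(1)] linear_scale[OF p(1)])
  qed
  show lin: "linear ?q"
  proof (rule linearI)
    show "?q (x + y) = ?q x + ?q y" for x y
      by (simp add: complex_eq_iff linear_add[OF p(1)] complex_vector.scale_right_distrib)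
    show "?q (r *\<^sub>R x) = r *\<^sub>R ?q x" for r x
      using pC[of "of_real r" x] pC[of "\<i> * of_real r" x] by (simp add: complex_eq_iff scaleR_scaleC scaleC_complex_def)
  qed
  show C: "?q (c *\<^sub>C b) = c * ?q b" for c b
    using pC[of c b] pC[of "\<i> * c" b] by (simp add: complex_eq_iff)
  show "cmod (?q b) \<le> norm b" for b
  proof -
    obtain c where c: "cmod c = 1" "c * ?q b = of_real (cmod (?q b))"
      using unit_times_eq_cmod by blast
    have "p (c *\<^sub>C b) = Re (?q (c *\<^sub>C b))" by simp
    also have "\<dots> = cmod (?q b)" unfolding C c(2) by simp
    finally show ?thesis using p(2)[of "c *\<^sub>C b"] c(1) by (simp add: norm_scaleC)
  qed
  show "Re (?q b) = p b" for b by simp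
qed

section \<open>Faces of the sphere of the algebra\<close>

context unif_alg
begin

definition face :: "'x \<Rightarrow> complex \<Rightarrow> ('x \<Rightarrow>\<^sub>C complex) set"
  where "face x c = {f \<in> unit_sphere A. apply_bcontfun f x = c}"

lemma face_subset: "face x c \<subseteq> unit_sphere A"
  by (auto simp: face_def)

lemma face_memI: "f \<in> A \<Longrightarrow> norm f \<le> 1 \<Longrightarrow> apply_bcontfun f x = c \<Longrightarrow> cmod c = 1 \<Longrightarrow> f \<in> face x c"
  using norm_bounded[of f x] by (simp add: face_def unit_sphere_def)

lemma const_mem_face: "cmod c = 1 \<Longrightarrow> const_bcontfun c \<in> face x c"
  by (intro face_memI mem_intros norm_bound) auto

lemma convex_face:
  assumes "cmod c = 1"
  shows "convex (face x c)"
proof (rule convexI)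
  fix f g and s t :: real
  assume fg: "f \<in> face x c" "g \<in> face x c" and st: "0 \<le> s" "0 \<le> t" "s + t = 1"
  then have *: "f \<in> A" "g \<in> A" "norm f = 1" "norm g = 1" "apply_bcontfun f x = c" "apply_bcontfun g x = c"
    by (auto simp: face_def unit_sphere_def)
  show "s *\<^sub>R f + t *\<^sub>R g \<in> face x c"
  proof (rule face_memI)
    show "s *\<^sub>R f + t *\<^sub>R g \<in> A" by (intro add_mem scaleR_mem *)
    show "norm (s *\<^sub>R f + t *\<^sub>R g) \<le> 1" by (rule norm_triangle_le) (use * st in simp)
    show "apply_bcontfun (s *\<^sub>R f + t *\<^sub>R g) x = c"
      using st(3) by (simp add: * flip: scaleR_add_left)
  qed (rule assms)
qed

text \<open>A convex \<open>G\<close> above the face lies in a face over some \<open>y\<close>. The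
  constant \<open>c\<close> belongs to both and fixes the value, and a multiple of a function
  peaking at \<open>x\<close> excludes \<open>y \<noteq> x\<close>.\<close>

lemma face_maximal:
  assumes x: "weak_peak_set {x}" and c: "cmod c = 1"
    and G: "convex G" "G \<subseteq> unit_sphere A" "face x c \<subseteq> G"
  shows "G = face x c"
proof -
  have cG: "const_bcontfun c \<in> G" using const_mem_face[OF c] G(3) by blast
  then have "G \<noteq> {}" by blast
  from convex_subset_face[OF G(1,2) this] obtain y d where yd: "\<forall>g\<in>G. apply_bcontfun g y = d"
    by (elim exE conjE)
  have d: "d = c" using bspec[OF yd cG] by simp
  have "y = x"
  proof (rule ccontr)
    assume "y \<noteq> x"
    then have "open (- {y})" "{x} \<subseteq> - {y}" by auto
    from weak_peak_setD[OF x this] obtain f where f: "f \<in> A" "norm f \<le> 1"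
      "\<forall>y\<in>{x}. apply_bcontfun f y = 1" "\<forall>z. z \<notin> - {y} \<longrightarrow> cmod (apply_bcontfun f z) < 1"
      by (elim bexE conjE)
    have "c *\<^sub>C f \<in> face x c"
      by (rule face_memI) (use f c in \<open>auto simp: scaleC_complex_def norm_scaleC intro: mem_intros\<close>)
    from bspec[OF yd subsetD[OF G(3) this]] have "c * apply_bcontfun f y = c"
      using d by (simp add: scaleC_complex_def)
    then have "apply_bcontfun f y = 1" using c by auto
    then show False using f(4) by auto
  qed
  then show ?thesis using G yd d by (auto simp: face_def)
qed

text \<open>For \<open>y \<noteq> x\<close> a function peaking at \<open>x\<close> with modulus at
  most \<open>(1 - r) / 2\<close> at \<open>y\<close> is at least \<open>(1 + r) / 2 > r\<close>
  away from anything unimodular at \<open>y\<close>.\<close>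

lemma face_near_imp_eq:
  assumes x: "weak_peak_set {x}" and c: "cmod c = 1" "cmod d = 1" and r: "r < 1"
    and near: "\<forall>f\<in>face x c. \<exists>g\<in>face y d. norm (f - g) \<le> r"
  shows "y = x"
proof (rule ccontr)
  assume "y \<noteq> x"
  then have op: "open (- {y})" "{x} \<subseteq> - {y}" and e: "(1 - r) / 2 > 0" using r by auto
  from weak_peak_set_sharp[OF x op e] obtain u where u: "u \<in> A"
    "\<forall>y. cmod (2 * apply_bcontfun u y - 1) \<le> 1"
    "\<forall>y\<in>{x}. apply_bcontfun u y = 1" "\<forall>z. z \<notin> - {y} \<longrightarrow> cmod (apply_bcontfun u z) \<le> (1 - r) / 2"
    by (elim bexE conjE)
  have "norm u \<le> 1" by (rule norm_bound, rule half_disc_cmod) (simp add: u(2))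
  then have "c *\<^sub>C u \<in> face x c"
    by (intro face_memI scaleC_mem u c) (simp_all add: norm_scaleC c scaleC_complex_def u(3))
  from bspec[OF near this] obtain g where g: "g \<in> face y d" "norm (c *\<^sub>C u - g) \<le> r" by (elim bexE)
  have gy: "apply_bcontfun g y = d" using g(1) by (simp add: face_def)
  have "cmod (c * apply_bcontfun u y - d) \<le> r"
    using cmod_apply_le[OF g(2), of y] by (simp add: gy scaleC_complex_def)
  moreover have "cmod d - cmod (c * apply_bcontfun u y) \<le> cmod (d - c * apply_bcontfun u y)"
    by (rule norm_triangle_ineq2)
  moreover have "cmod (c * apply_bcontfun u y) \<le> (1 - r) / 2" using u(4) c by (simp add: norm_mult)
  ultimately show False using c r by (simp add: norm_minus_commute field_simps)
qed

end

section \<open>Images of faces under the isometry and the functionals they define\<close>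

locale unif_alg_sphere_isometry = unif_alg A
  for A :: "('x::t2_space \<Rightarrow>\<^sub>C complex) set" +
  fixes B :: "'b::complex_normed_vector set" and T :: "('x \<Rightarrow>\<^sub>C complex) \<Rightarrow> 'b"
  assumes B: "complex_vector.subspace B"
    and T: "surjective_isometry (unit_sphere A) (unit_sphere B) T"
begin

lemma T_image: "T ` unit_sphere A = unit_sphere B"
  using T by (simp add: surjective_isometry_def)

lemma T_mem: "a \<in> unit_sphere A \<Longrightarrow> T a \<in> unit_sphere B"
  using T_image by blast

lemma T_iso: "a \<in> unit_sphere A \<Longrightarrow> b \<in> unit_sphere A \<Longrightarrow> norm (T a - T b) = norm (a - b)"
  using T by (simp add: surjective_isometry_def dist_norm)

lemma T_inj: "inj_on T (unit_sphere A)"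
  by (rule surjective_isometry_inj[OF T])

lemma scaleC_sphere: "b \<in> unit_sphere B \<Longrightarrow> cmod c = 1 \<Longrightarrow> c *\<^sub>C b \<in> unit_sphere B"
  by (simp add: unit_sphere_def norm_scaleC complex_vector.subspace_scale[OF B])

lemma convex_scaleC_image: "convex D \<Longrightarrow> convex ((*\<^sub>C) c ` D)" for D :: "'b set"
  by (rule convex_linear_image)
    (auto intro!: linearI simp: complex_vector.scale_right_distrib scaleR_scaleC mult.commute)

text \<open>The pullback of \<open>G\<close> need not be convex, but its hull stays on the sphere
  and contains the face, so maximality of the face applies to the hull.\<close>

lemma face_image_maximal:
  assumes x: "weak_peak_set {x}" and c: "cmod c = 1"
    and G: "convex G" "G \<subseteq> unit_sphere B" "T ` face x c \<subseteq> G"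
  shows "G = T ` face x c"
proof -
  let ?S = "inv_into (unit_sphere A) T"
  note subA = complex_subspace_imp_subspace[OF subspace_A]
  have hull: "convex hull (?S ` G) \<subseteq> unit_sphere A"
    by (rule spherical_isometry_convex_hull_image[OF subA surjective_isometry_inv_into[OF T] G(1,2)])
  have "face x c \<subseteq> ?S ` G"
  proof
    fix f assume f: "f \<in> face x c"
    then have "f \<in> unit_sphere A" using face_subset by blast
    then have "?S (T f) = f" by (rule inv_into_f_f[OF T_inj])
    moreover have "T f \<in> G" using f G(3) by blast
    ultimately show "f \<in> ?S ` G" by (metis image_eqI)
  qed
  then have "face x c \<subseteq> convex hull (?S ` G)" using hull_subset[of "?S ` G" convex] by (rule order_trans)
  from face_maximal[OF x c convex_convex_hull hull this]
  have SG: "?S ` G \<subseteq> face x c" using hull_subset[of "?S ` G" convex] by simp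
  have "G \<subseteq> T ` face x c"
  proof
    fix g assume g: "g \<in> G"
    then have "T (?S g) = g" using G(2) T_image by (intro f_inv_into_f) auto
    moreover have "?S g \<in> face x c" using SG g by blast
    ultimately show "g \<in> T ` face x c" by (metis image_eqI)
  qed
  then show ?thesis using G(3) by (rule equalityI)
qed

lemma convex_face_image:
  assumes x: "weak_peak_set {x}" and c: "cmod c = 1"
  shows "convex (T ` face x c)"
proof -
  have "convex hull (T ` face x c) = T ` face x c"
    by (rule face_image_maximal[OF x c convex_convex_hull _ hull_subset])
      (rule spherical_isometry_convex_hull_image[OF complex_subspace_imp_subspace[OF B] T convex_face[OF c] face_subset])
  then show ?thesis by (metis convex_convex_hull)
qed

text \<open>The rotated image pulls back into a face over some \<open>y\<close>. Since the rotation
  moves unit vectors by \<open>cmod (1 - m) < 1\<close>, every member of the original face has a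
  point of the new one closer than 1, so \<open>y = x\<close>.\<close>

lemma face_image_rotate_near:
  assumes x: "weak_peak_set {x}" and c: "cmod c = 1" and m: "cmod m = 1" "cmod (1 - m) < 1"
  shows "\<exists>d. cmod d = 1 \<and> (*\<^sub>C) m ` T ` face x c = T ` face x d"
proof -
  let ?S = "inv_into (unit_sphere A) T" and ?D = "T ` face x c"
  let ?G = "(*\<^sub>C) m ` ?D"
  note subA = complex_subspace_imp_subspace[OF subspace_A]
  have DB: "?D \<subseteq> unit_sphere B" using face_subset T_mem by blast
  have GB: "?G \<subseteq> unit_sphere B" using DB scaleC_sphere[OF _ m(1)] by blast
  have convG: "convex ?G" by (rule convex_scaleC_image[OF convex_face_image[OF x c]])
  have hull: "convex hull (?S ` ?G) \<subseteq> unit_sphere A"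
    by (rule spherical_isometry_convex_hull_image[OF subA surjective_isometry_inv_into[OF T] convG GB])
  have "convex hull (?S ` ?G) \<noteq> {}" using const_mem_face[OF c, of x] by auto
  from convex_subset_face[OF convex_convex_hull hull this]
  obtain y d where yd: "weak_peak_set {y}" "cmod d = 1" "\<forall>g\<in>convex hull (?S ` ?G). apply_bcontfun g y = d"
    by (elim exE conjE)
  have S_face: "?S b \<in> face y d" if "b \<in> ?G" for b
  proof -
    have "?S b \<in> convex hull (?S ` ?G)" by (rule hull_inc) (use that in blast)
    then show ?thesis using hull yd(3) by (auto simp: face_def)
  qed
  have TS: "T (?S b) = b" if "b \<in> ?G" for b
    using GB that T_image by (intro f_inv_into_f) auto
  have "y = x"
  proof (rule face_near_imp_eq[OF x c yd(2) m(2)], rule ballI)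
    fix f assume f: "f \<in> face x c"
    then have fA: "f \<in> unit_sphere A" using face_subset by blast
    have mf: "m *\<^sub>C T f \<in> ?G" using f by blast
    then have SA: "?S (m *\<^sub>C T f) \<in> unit_sphere A" using S_face face_subset by blast
    have "norm (f - ?S (m *\<^sub>C T f)) = norm (T f - m *\<^sub>C T f)"
      using T_iso[OF fA SA] TS[OF mf] by simp
    also have "T f - m *\<^sub>C T f = (1 - m) *\<^sub>C T f" by (simp add: complex_vector.scale_left_diff_distrib)
    also have "norm \<dots> = cmod (1 - m)" using T_mem[OF fA] by (simp add: norm_scaleC unit_sphere_def)
    finally show "\<exists>g\<in>face y d. norm (f - g) \<le> cmod (1 - m)"
      using S_face[OF mf] by (intro bexI[of _ "?S (m *\<^sub>C T f)"]) simp_all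
  qed
  \<comment> \<open>So far only one inclusion is known. Rotating back gives a convex set containing
    \<open>?D\<close>, and maximality of \<open>?D\<close> turns the inclusion into an
    equality.\<close>
  let ?H = "(*\<^sub>C) (cnj m) ` T ` face x d"
  have mm: "cnj m * m = 1" "m * cnj m = 1" using m(1) by (simp_all add: mult.commute complex_norm_square[symmetric])
  have GT: "?G \<subseteq> T ` face x d"
  proof
    fix b assume b: "b \<in> ?G"
    show "b \<in> T ` face x d" using S_face[OF b] TS[OF b] \<open>y = x\<close> by (metis image_eqI)
  qed
  have "?H = ?D"
  proof (rule face_image_maximal[OF x c])
    show "convex ?H" by (rule convex_scaleC_image[OF convex_face_image[OF x yd(2)]])
    show "?H \<subseteq> unit_sphere B"
    proof
      fix b assume "b \<in> ?H"
      then obtain f where f: "f \<in> face x d" "b = cnj m *\<^sub>C T f" by blast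
      have "T f \<in> unit_sphere B" by (rule T_mem) (use f(1) face_subset in blast)
      then show "b \<in> unit_sphere B" unfolding f(2) by (rule scaleC_sphere) (simp add: m)
    qed
    show "?D \<subseteq> ?H"
    proof
      fix b assume b: "b \<in> ?D"
      then have "m *\<^sub>C b \<in> T ` face x d" using GT by blast
      moreover have "b = cnj m *\<^sub>C (m *\<^sub>C b)" using mm by simp
      ultimately show "b \<in> ?H" by blast
    qed
  qed
  then have "?G = (*\<^sub>C) m ` ?H" by simp
  also have "\<dots> = T ` face x d" by (simp add: image_image mm)
  finally show ?thesis using yd(2) by blast
qed

lemma face_image_rotate:
  assumes x: "weak_peak_set {x}" and c: "cmod c = 1" and m: "cmod m = 1"
  shows "\<exists>d. cmod d = 1 \<and> (*\<^sub>C) m ` T ` face x c = T ` face x d"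
proof -
  obtain r where r: "cmod r = 1" "cmod (1 - r) < 1" "m = r * r * (r * r)"
    using fourth_root_near_1[OF m] by (elim exE conjE)
  note near = face_image_rotate_near[OF x _ r(1,2)]
  obtain d1 where d1: "cmod d1 = 1" "(*\<^sub>C) r ` T ` face x c = T ` face x d1" using near[OF c] by (elim exE conjE)
  obtain d2 where d2: "cmod d2 = 1" "(*\<^sub>C) r ` T ` face x d1 = T ` face x d2" using near[OF d1(1)] by (elim exE conjE)
  obtain d3 where d3: "cmod d3 = 1" "(*\<^sub>C) r ` T ` face x d2 = T ` face x d3" using near[OF d2(1)] by (elim exE conjE)
  obtain d4 where d4: "cmod d4 = 1" "(*\<^sub>C) r ` T ` face x d3 = T ` face x d4" using near[OF d3(1)] by (elim exE conjE)
  have "(*\<^sub>C) m ` T ` face x c = (*\<^sub>C) r ` (*\<^sub>C) r ` (*\<^sub>C) r ` (*\<^sub>C) r ` T ` face x c"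
    by (simp add: r(3) image_image mult.assoc)
  also have "\<dots> = T ` face x d4" by (simp only: d1 d2 d3 d4)
  finally show ?thesis using d4(1) by blast
qed

text \<open>\<open>s\<close> is the identity or the conjugation, and which of them may vary with
  \<open>x\<close>. Only what both share, real linearity and preservation of the modulus, is needed
  for the extension.\<close>

lemma point_functional:
  assumes x: "weak_peak_set {x}"
  shows "\<exists>q s. linear q \<and> linear s \<and> (\<forall>b. cmod (q b) \<le> norm b) \<and> (\<forall>z. cmod (s z) = cmod z) \<and>
    (\<forall>a\<in>unit_sphere A. q (T a) = s (apply_bcontfun a x))"
proof -
  let ?D = "T ` face x 1"
  have one: "cmod 1 = 1" by simp
  have DB: "\<And>b. b \<in> ?D \<Longrightarrow> norm b = 1" using T_mem face_subset by (force simp: unit_sphere_def)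
  have "\<exists>p. linear p \<and> (\<forall>b. p b \<le> norm b) \<and> (\<forall>b\<in>?D. p b = 1)"
    by (rule convex_sphere_functional[OF convex_face_image[OF x one]]) (rule DB)
  then obtain p where p: "linear p" "\<forall>b. p b \<le> norm b" "\<forall>b\<in>?D. p b = 1"
    by (elim exE conjE)
  obtain q where q: "linear q" "\<forall>c b. q (c *\<^sub>C b) = c * q b" "\<forall>b. cmod (q b) \<le> norm b"
      "\<forall>b. Re (q b) = p b"
    using complexify_functional[OF p(1) p(2)[rule_format]] by (elim exE conjE)
  have qD: "q b = 1" if "b \<in> ?D" for b
  proof (rule cmod_le_1_Re_eq_1)
    show "cmod (q b) \<le> 1" using q(3)[rule_format, of b] DB[OF that] by simp
    show "Re (q b) = 1" using bspec[OF p(3) that] q(4) by simp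
  qed
  have "\<forall>m\<in>{m. cmod m = 1}. \<exists>d. cmod d = 1 \<and> (*\<^sub>C) m ` ?D = T ` face x d"
    using face_image_rotate[OF x one] by simp
  from bchoice[OF this] obtain t where
    "\<forall>m\<in>{m. cmod m = 1}. cmod (t m) = 1 \<and> (*\<^sub>C) m ` ?D = T ` face x (t m)"
    by (elim exE)
  then have t: "\<And>m. cmod m = 1 \<Longrightarrow> cmod (t m) = 1"
      "\<And>m. cmod m = 1 \<Longrightarrow> (*\<^sub>C) m ` ?D = T ` face x (t m)"
    by simp_all
  have qt: "q (T f) = m" if "cmod m = 1" "f \<in> face x (t m)" for m f
  proof -
    have "T f \<in> (*\<^sub>C) m ` ?D" using t(2)[OF that(1)] that(2) by blast
    then obtain b where "b \<in> ?D" "T f = m *\<^sub>C b" by blast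
    then show ?thesis using q(2) qD by simp
  qed
  \<comment> \<open>One inequality evaluates at \<open>x\<close> the preimages of two rotations of
    one vector; the other applies \<open>q\<close> to the images of two constants.\<close>
  have t_iso: "cmod (t m - t n) = cmod (m - n)" if mn: "cmod m = 1" "cmod n = 1" for m n
  proof (rule antisym)
    obtain b where b: "b \<in> ?D" using const_mem_face[OF one, of x] by blast
    obtain f where f: "f \<in> face x (t m)" "m *\<^sub>C b = T f" using t(2)[OF mn(1)] b by blast
    obtain g where g: "g \<in> face x (t n)" "n *\<^sub>C b = T g" using t(2)[OF mn(2)] b by blast
    have "cmod (t m - t n) = cmod (apply_bcontfun (f - g) x)" using f(1) g(1) by (simp add: face_def)
    also have "\<dots> \<le> norm (f - g)" by (rule norm_bounded)
    also have "\<dots> = norm (T f - T g)" using f(1) g(1) face_subset by (intro T_iso[symmetric]) auto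
    also have "T f - T g = (m - n) *\<^sub>C b"
      by (simp add: complex_vector.scale_left_diff_distrib flip: f(2) g(2))
    also have "norm \<dots> = cmod (m - n)" using DB[OF b] by (simp add: norm_scaleC)
    finally show "cmod (t m - t n) \<le> cmod (m - n)" .
    let ?f = "const_bcontfun (t m) :: 'x \<Rightarrow>\<^sub>C complex" and ?g = "const_bcontfun (t n)"
    have fg: "?f \<in> face x (t m)" "?g \<in> face x (t n)" using t(1) mn by (auto intro: const_mem_face)
    have "m - n = q (T ?f - T ?g)" using qt[OF mn(1) fg(1)] qt[OF mn(2) fg(2)] by (simp add: linear_diff[OF q(1)])
    then have "cmod (m - n) \<le> norm (T ?f - T ?g)" using q(3) by simp
    also have "\<dots> = norm (?f - ?g)" using fg face_subset by (intro T_iso) auto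
    also have "\<dots> \<le> cmod (t m - t n)" by (rule norm_bound) simp
    finally show "cmod (m - n) \<le> cmod (t m - t n)" .
  qed
  have t1: "t 1 = 1"
  proof -
    have "T (const_bcontfun 1) \<in> ?D" using const_mem_face[OF one] by blast
    also have "?D = T ` face x (t 1)" using t(2)[OF one] by simp
    finally obtain f where f: "f \<in> face x (t 1)" "T (const_bcontfun 1) = T f" by blast
    have "const_bcontfun 1 = f"
      by (rule inj_onD[OF T_inj f(2)]) (use f(1) const_mem_face[OF one] face_subset in blast)+
    then show ?thesis using f(1) by (auto simp: face_def)
  qed
  obtain s :: "complex \<Rightarrow> complex" where s: "s = (\<lambda>z. z) \<or> s = cnj" "\<And>m. cmod m = 1 \<Longrightarrow> t m = s m"
    using circle_isometry_cases[OF t(1) t_iso t1] by metis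
  have lin: "linear s" using s(1) by (auto intro!: linearI)
  have ss: "s (s z) = z" "cmod (s z) = cmod z" "s (- z) = - s z" "s (of_real r * z) = of_real r * s z" for z r
    using s(1) by auto
  have "q (T a) = s (apply_bcontfun a x)" if a: "a \<in> unit_sphere A" for a
  proof -
    let ?z = "apply_bcontfun a x"
    have aA: "a \<in> A" "norm a \<le> 1" using a by (auto simp: unit_sphere_def)
    define r where "r = cmod ?z"
    have r: "0 \<le> r" "r \<le> 1" using cmod_apply_le[OF aA(2)] by (auto simp: r_def)
    \<comment> \<open>For \<open>?z = 0\<close> any unimodular \<open>c\<close> serves, since then
      \<open>r = 0\<close>.\<close>
    define c where "c = (if ?z = 0 then 1 else ?z / of_real r)"
    have c: "cmod c = 1" "?z = of_real r * c"
      by (simp_all add: c_def r_def norm_divide)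
    have dist: "cmod (q (T a) - s l) \<le> 1 - u"
      if l: "cmod l = 1" and u: "\<bar>u\<bar> \<le> 1" "?z = of_real u * l" for l u
    proof (rule field_le_epsilon)
      fix e :: real assume "0 < e"
      from face_distance[OF x aA l u this] obtain b where b: "b \<in> unit_sphere A" "apply_bcontfun b x = l"
        "norm (a - b) \<le> 1 - u + e" by (elim bexE conjE)
      have sl: "cmod (s l) = 1" using l ss by simp
      \<comment> \<open>\<open>s\<close> is an involution agreeing with \<open>t\<close> on the
        circle, so \<open>t (s l) = l\<close>.\<close>
      have "b \<in> face x (t (s l))" using b s(2)[OF sl] ss by (simp add: face_def)
      then have "q (T b) = s l" by (rule qt[OF sl])
      then have "q (T a) - s l = q (T a - T b)" by (simp add: linear_diff[OF q(1)])
      also have "cmod \<dots> \<le> norm (T a - T b)" using q(3) by blast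
      also have "\<dots> \<le> 1 - u + e" using T_iso[OF a b(1)] b(3) by simp
      finally show "cmod (q (T a) - s l) \<le> 1 - u + e" .
    qed
    have "q (T a) = of_real r * s c"
    proof (rule tangent_discs_meet)
      show "cmod (q (T a) - s c) \<le> 1 - r" using dist[of c r] c r by simp
      show "cmod (q (T a) + s c) \<le> 1 + r" using dist[of "- c" "- r"] c r ss by simp
      show "cmod (s c) = 1" using c ss by simp
    qed
    then show ?thesis using c(2) ss(4) by simp
  qed
  then show ?thesis using q(1,3) lin ss(2) by blast
qed

section \<open>The homogeneous extension\<close>

definition extension :: "('x \<Rightarrow>\<^sub>C complex) \<Rightarrow> 'b"
  where "extension a = norm a *\<^sub>R T ((1 / norm a) *\<^sub>R a)"

lemma extension_eq: "a \<in> unit_sphere A \<Longrightarrow> extension a = T a"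
  by (simp add: extension_def unit_sphere_def)

lemma normalize_mem: "a \<in> A \<Longrightarrow> a \<noteq> 0 \<Longrightarrow> (1 / norm a) *\<^sub>R a \<in> unit_sphere A"
  by (simp add: unit_sphere_def scaleR_mem)

lemma extension_mem:
  assumes "a \<in> A"
  shows "extension a \<in> B" "norm (extension a) = norm a"
proof -
  note subB = complex_subspace_imp_subspace[OF B]
  have "extension a \<in> B \<and> norm (extension a) = norm a"
  proof (cases "a = 0")
    case False
    have "T ((1 / norm a) *\<^sub>R a) \<in> unit_sphere B" by (rule T_mem[OF normalize_mem[OF assms False]])
    then show ?thesis by (simp add: extension_def unit_sphere_def subspace_scale[OF subB])
  qed (simp add: extension_def subspace_0[OF subB])
  then show "extension a \<in> B" "norm (extension a) = norm a" by simp_all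
qed

lemma functional_extension:
  assumes "linear q" "linear s" "\<forall>a\<in>unit_sphere A. q (T a) = s (apply_bcontfun a x)" "a \<in> A"
  shows "q (extension a) = s (apply_bcontfun a x)"
proof (cases "a = 0")
  \<comment> \<open>At 0 the factor \<open>norm a\<close> annihilates \<open>T 0\<close>, about
    which nothing is assumed.\<close>
  case True
  then show ?thesis by (simp add: extension_def linear_0[OF assms(1)] linear_0[OF assms(2)])
next
  case False
  have "q (extension a) = norm a *\<^sub>R s ((1 / norm a) *\<^sub>R apply_bcontfun a x)"
    using bspec[OF assms(3) normalize_mem[OF assms(4) False]]
    by (simp add: extension_def linear_scale[OF assms(1)])
  then show ?thesis using False by (simp add: linear_scale[OF assms(2)])
qed

text \<open>A nonzero \<open>b\<close> is a multiple of some \<open>T a\<close>. The singleton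
  \<open>{a}\<close> is convex, so \<open>a\<close> is unimodular at some weak peak point, and the
  functional there has modulus 1 at \<open>T a\<close>.\<close>

lemma separating_functionals:
  assumes b: "b \<in> B" and zero: "\<And>x q s. weak_peak_set {x} \<Longrightarrow> linear q \<Longrightarrow> linear s \<Longrightarrow>
    \<forall>a\<in>unit_sphere A. q (T a) = s (apply_bcontfun a x) \<Longrightarrow> q b = (0 :: complex)"
  shows "b = 0"
proof (rule ccontr)
  assume nz: "b \<noteq> 0"
  have "(1 / norm b) *\<^sub>R b \<in> unit_sphere B"
    using nz b complex_subspace_imp_subspace[OF B] by (simp add: unit_sphere_def subspace_scale)
  then obtain a where a: "a \<in> unit_sphere A" "T a = (1 / norm b) *\<^sub>R b" using T_image by (metis imageE)
  obtain x c where xc: "weak_peak_set {x}" "cmod c = 1" "\<forall>g\<in>{a}. apply_bcontfun g x = c"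
    using convex_subset_face[of "{a}"] a(1) by auto
  from point_functional[OF xc(1)] obtain q s where qs: "linear q" "linear s" "\<forall>z. cmod (s z) = cmod z"
    "\<forall>a\<in>unit_sphere A. q (T a) = s (apply_bcontfun a x)" by (elim exE conjE)
  have "cmod (q (T a)) = 1" using bspec[OF qs(4) a(1)] qs(3) xc by simp
  moreover have "q (T a) = 0"
    unfolding a(2) linear_scale[OF qs(1)] using zero[OF xc(1) qs(1,2,4)] by simp
  ultimately show False by simp
qed

lemma real_linear_on_extension: "real_linear_on A extension"
proof -
  note subB = complex_subspace_imp_subspace[OF B]
  have add: "extension (f + g) = extension f + extension g" if fg: "f \<in> A" "g \<in> A" for f g
  proof -
    have "extension (f + g) - (extension f + extension g) = 0"
    proof (rule separating_functionals)
      show "extension (f + g) - (extension f + extension g) \<in> B"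
        by (intro subspace_diff[OF subB] subspace_add[OF subB] extension_mem add_mem fg)
      fix x and q :: "'b \<Rightarrow> complex" and s
      assume "linear q" "linear s" "\<forall>a\<in>unit_sphere A. q (T a) = s (apply_bcontfun a x)"
      note * = functional_extension[OF this]
      show "q (extension (f + g) - (extension f + extension g)) = 0"
        unfolding linear_diff[OF \<open>linear q\<close>] linear_add[OF \<open>linear q\<close>] *[OF add_mem[OF fg]] *[OF fg(1)] *[OF fg(2)]
        by (simp add: linear_add[OF \<open>linear s\<close>])
    qed
    then show ?thesis by simp
  qed
  have scale: "extension (r *\<^sub>R f) = r *\<^sub>R extension f" if f: "f \<in> A" for r f
  proof -
    have "extension (r *\<^sub>R f) - r *\<^sub>R extension f = 0"
    proof (rule separating_functionals)
      show "extension (r *\<^sub>R f) - r *\<^sub>R extension f \<in> B"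
        by (intro subspace_diff[OF subB] subspace_scale[OF subB] extension_mem scaleR_mem f)
      fix x and q :: "'b \<Rightarrow> complex" and s
      assume "linear q" "linear s" "\<forall>a\<in>unit_sphere A. q (T a) = s (apply_bcontfun a x)"
      note * = functional_extension[OF this]
      show "q (extension (r *\<^sub>R f) - r *\<^sub>R extension f) = 0"
        unfolding linear_diff[OF \<open>linear q\<close>] linear_scale[OF \<open>linear q\<close>] *[OF scaleR_mem[OF f]] *[OF f]
        by (simp add: linear_scale[OF \<open>linear s\<close>])
    qed
    then show ?thesis by simp
  qed
  show ?thesis using add scale by (simp add: real_linear_on_def)
qed

text \<open>Norms are preserved by construction, so additivity gives the isometry; surjectivity
  passes from the spheres by scaling.\<close>

lemma surjective_isometry_extension: "surjective_isometry A B extension"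
  unfolding surjective_isometry_def
proof (intro conjI ballI)
  show "extension ` A = B"
  proof (intro equalityI subsetI)
    fix b assume b: "b \<in> B"
    show "b \<in> extension ` A"
    proof (cases "b = 0")
      case True
      have "extension 0 = 0" by (simp add: extension_def)
      then show ?thesis using True zero_mem by (metis image_eqI)
    next
      case False
      have "(1 / norm b) *\<^sub>R b \<in> unit_sphere B"
        using False b complex_subspace_imp_subspace[OF B] by (simp add: unit_sphere_def subspace_scale)
      then obtain a where a: "a \<in> unit_sphere A" "T a = (1 / norm b) *\<^sub>R b" using T_image by (metis imageE)
      have aA: "a \<in> A" using a(1) by (simp add: unit_sphere_def)
      have "extension (norm b *\<^sub>R a) = norm b *\<^sub>R T a"
        using real_linear_on_extension aA extension_eq[OF a(1)] by (simp add: real_linear_on_def)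
      then have "extension (norm b *\<^sub>R a) = b" using a(2) False by simp
      then show ?thesis using scaleR_mem[OF aA] by (metis image_eqI)
    qed
  qed (use extension_mem in blast)
  fix f g assume fg: "f \<in> A" "g \<in> A"
  have "extension ((f - g) + g) = extension (f - g) + extension g"
    using real_linear_on_extension diff_mem[OF fg] fg(2) by (simp only: real_linear_on_def)
  then have "extension f - extension g = extension (f - g)" by simp
  then show "dist (extension f) (extension g) = dist f g"
    using extension_mem(2)[OF diff_mem[OF fg]] by (simp add: dist_norm)
qed

end

theorem theorem4p5:
  fixes A :: "('x::t2_space \<Rightarrow>\<^sub>C complex) set"
  assumes "uniform_algebra A"
  shows "complex_mazur_ulam TYPE('b::complex_normed_vector) A"
proof -
  interpret unif_alg A by (rule unif_alg.intro) (rule assms)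
  show ?thesis
    unfolding complex_mazur_ulam_def
  proof (intro conjI allI impI)
    show "complex_banach_space A"
      using subspace_A complete_A by (simp add: complex_banach_space_def)
    fix B :: "'b set" and T
    assume "complex_banach_space B" "surjective_isometry (unit_sphere A) (unit_sphere B) T"
    then interpret unif_alg_sphere_isometry A B T
      by unfold_locales (simp_all add: complex_banach_space_def)
    show "\<exists>F. surjective_isometry A B F \<and> real_linear_on A F \<and> (\<forall>a\<in>unit_sphere A. F a = T a)"
      using surjective_isometry_extension real_linear_on_extension extension_eq by blast
  qed
qed

end
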